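(* Let $K$ be a field, $T=K[x_0,\ldots,x_n]$, $S=K[y_0,\ldots,y_n]$ acting on $T$ by differentiation, and let $F\in T$ be a nonzero homogeneous form with annihilator ideal $F^{\bot}\subset S$. Let $d\ge 1$ be an integer such that the ideal $F^{\bot}$ is generated in degree $d$. If $\Gamma\subset \mathbf{P}(T_1)$ is a finite subscheme that is apolar to $F$, then $$\deg \Gamma\;\geq\; \frac{1}{d}\,\deg F^{\bot}.$$
   Context: The ring $S=K[y_0,\ldots,y_n]$ is regarded as the ring of commuting differential operators acting on $T=K[x_0,\ldots,x_n]$, with $y_i$ acting as $\partial/\partial x_i$ (this action is called apolarity). It makes $S$, with its standard grading, the homogeneous coordinate ring of the projective space $\mathbf{P}(T_1)$ of $1$-dimensional subspaces of the space $T_1$ of linear forms, so $\mathbf{P}(T_1)\cong \operatorname{Proj} S\cong\mathbf{P}^n_K$. The annihilator of $F$ is the homogeneous ideal $F^{\bot}=\{g\in S : g\cdot F=0\}\subset S$. The quotient $S_F=S/F^{\bot}$ is a finite-dimensional $K$-algebra, and the degree of $F^{\bot}$ is defined as its length: $\deg F^{\bot}=\dim_K S/F^{\bot}$. "$F^{\bot}$ is generated in degree $d$" means that $F^{\bot}$ can be generated by homogeneous elements of degree at most $d$. A finite (i.e. zero-dimensional) closed subscheme $\Gamma\subset\mathbf{P}(T_1)$ is apolar to $F$ if its (saturated) homogeneous ideal $I_\Gamma\subset S$ satisfies $I_\Gamma\subset F^{\bot}$. The degree of $\Gamma$ is its length, $\deg\Gamma=\dim_K H^0(\Gamma,\mathcal{O}_\Gamma)$.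 *)

theory Defs
  imports Complex_Main "HOL-Library.Poly_Mapping" "HOL-Library.Function_Algebras"
begin

text \<open>The variables are indexed by a finite type \<open>'v\<close> with \<open>n + 1\<close> elements
  (\<open>n \<ge> 0\<close> because types are nonempty).  A polynomial is a finitely supported map from exponent
  vectors to coefficients; its multiplication is convolution.  The same type serves for \<open>S\<close> and
  \<open>T\<close>.  Allowing integer exponents gives the Laurent polynomials, which contain the localizations
  of \<open>S\<close> at products of variables.\<close>

type_synonym ('v, 'k) mpoly = "('v \<Rightarrow>\<^sub>0 nat) \<Rightarrow>\<^sub>0 'k"
type_synonym ('v, 'k) laurent = "('v \<Rightarrow>\<^sub>0 int) \<Rightarrow>\<^sub>0 'k"

definition mdeg :: "('v::finite \<Rightarrow>\<^sub>0 nat) \<Rightarrow> nat"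
  where "mdeg m = (\<Sum>i\<in>UNIV. Poly_Mapping.lookup m i)"

definition form :: "nat \<Rightarrow> ('v::finite, 'k::field) mpoly \<Rightarrow> bool"
  where "form e f \<longleftrightarrow> (\<forall>m\<in>Poly_Mapping.keys f. mdeg m = e)"

definition var :: "'v \<Rightarrow> ('v, 'k::field) mpoly"
  where "var i = Poly_Mapping.single (Poly_Mapping.single i 1) 1"

text \<open>Constants act on every polynomial ring by multiplication.\<close>

definition cscale :: "'k::field \<Rightarrow> ('a::comm_monoid_add \<Rightarrow>\<^sub>0 'k) \<Rightarrow> ('a \<Rightarrow>\<^sub>0 'k)"
  where "cscale c f = Poly_Mapping.single 0 c * f"


section \<open>Dimension of a quotient of vector spaces\<close>

text \<open>For subspaces \<open>W \<subseteq> V\<close>: the classes of the elements of \<open>B\<close> form a finite basis of \<open>V / W\<close>, and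
  no two elements of \<open>B\<close> have the same class.\<close>

definition finite_basis_mod ::
    "('k::field \<Rightarrow> 'b \<Rightarrow> 'b) \<Rightarrow> 'b set \<Rightarrow> 'b set \<Rightarrow> 'b::ab_group_add set \<Rightarrow> bool"
  where "finite_basis_mod scale V W B \<longleftrightarrow> finite B \<and> B \<subseteq> V \<and>
    (\<forall>v\<in>V. \<exists>!c. (\<forall>b. b \<notin> B \<longrightarrow> c b = 0) \<and> v - (\<Sum>b\<in>B. scale (c b) b) \<in> W)"

definition quot_finite_dim ::
    "('k::field \<Rightarrow> 'b \<Rightarrow> 'b) \<Rightarrow> 'b set \<Rightarrow> 'b::ab_group_add set \<Rightarrow> bool"
  where "quot_finite_dim scale V W \<longleftrightarrow> (\<exists>B. finite_basis_mod scale V W B)"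

text \<open>Meaningful only if the quotient is finite-dimensional.\<close>

definition quot_dim :: "('k::field \<Rightarrow> 'b \<Rightarrow> 'b) \<Rightarrow> 'b set \<Rightarrow> 'b::ab_group_add set \<Rightarrow> nat"
  where "quot_dim scale V W = (THE n. \<exists>B. finite_basis_mod scale V W B \<and> card B = n)"


section \<open>Apolarity\<close>

definition partial :: "'v \<Rightarrow> ('v, 'k::field) mpoly \<Rightarrow> ('v, 'k) mpoly"
  where "partial i F = (\<Sum>m\<in>Poly_Mapping.keys F.
    Poly_Mapping.single (m - Poly_Mapping.single i 1)
      (of_nat (Poly_Mapping.lookup m i) * Poly_Mapping.lookup F m))"

text \<open>The differential operator of a monomial is the composition of the powers of the partial
  derivatives over all variables; the order is irrelevant because they commute (shown below).\<close>

definition monom_act :: "('v::finite \<Rightarrow>\<^sub>0 nat) \<Rightarrow> ('v, 'k::field) mpoly \<Rightarrow> ('v, 'k) mpoly"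
  where "monom_act m F = Finite_Set.fold (\<lambda>i. partial i ^^ Poly_Mapping.lookup m i) F UNIV"

definition diff_act :: "('v::finite, 'k::field) mpoly \<Rightarrow> ('v, 'k) mpoly \<Rightarrow> ('v, 'k) mpoly"
  where "diff_act g F =
    (\<Sum>m\<in>Poly_Mapping.keys g. cscale (Poly_Mapping.lookup g m) (monom_act m F))"

definition annihilator :: "('v::finite, 'k::field) mpoly \<Rightarrow> ('v, 'k) mpoly set"
  where "annihilator F = {g. diff_act g F = 0}"

definition ideal_degree :: "('v, 'k::field) mpoly set \<Rightarrow> nat"
  where "ideal_degree I = quot_dim cscale UNIV I"

text \<open>The span in the module \<open>S\<close> over itself is the generated ideal.\<close>

definition generated_in_degree :: "nat \<Rightarrow> ('v::finite, 'k::field) mpoly set \<Rightarrow> bool"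
  where "generated_in_degree d I \<longleftrightarrow>
    (\<exists>G. (\<forall>g\<in>G. \<exists>e\<le>d. form e g) \<and> module.span (*) G = I)"

lemma lookup_partial:
  "Poly_Mapping.lookup (partial i F) m =
     of_nat (Poly_Mapping.lookup m i + 1) * Poly_Mapping.lookup F (m + Poly_Mapping.single i 1)"
proof -
  let ?e = "Poly_Mapping.single i (1::nat)"
  have *: "Poly_Mapping.lookup (Poly_Mapping.single (k - ?e) (of_nat (Poly_Mapping.lookup k i) * Poly_Mapping.lookup F k)) m =
      (if k = m + ?e then of_nat (Poly_Mapping.lookup m i + 1) * Poly_Mapping.lookup F (m + ?e) else 0)" for k
  proof (cases "Poly_Mapping.lookup k i = 0")
    case True
    then have "k \<noteq> m + ?e"
      by (auto simp: lookup_add)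
    with True show ?thesis by simp
  next
    case False
    then have k: "k - ?e + ?e = k"
      by (intro poly_mapping_eqI) (auto simp: lookup_add lookup_minus lookup_single when_def)
    have "k - ?e = m \<longleftrightarrow> k = m + ?e"
      using k by auto
    then show ?thesis
      by (auto simp: lookup_single when_def lookup_add)
  qed
  show ?thesis
    unfolding partial_def lookup_sum
    by (subst sum.cong[OF refl *]) (auto simp: sum.delta' in_keys_iff)
qed

lemma partial_commute: "partial i (partial j F) = partial j (partial i F)"
  by (rule poly_mapping_eqI)
    (auto simp: lookup_partial lookup_add lookup_single when_def ac_simps)

lemma comp_fun_commute_partial_power:
  "comp_fun_commute (\<lambda>i. (partial i :: ('v, 'k::field) mpoly \<Rightarrow> _) ^^ k i)"
proof -
  interpret comp_fun_commute "partial :: 'v \<Rightarrow> ('v, 'k) mpoly \<Rightarrow> _"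
    by standard (auto simp: partial_commute)
  show ?thesis by (rule comp_fun_commute_funpow)
qed

lemma diff_act_var:
  fixes F :: "('v::finite, 'k::field) mpoly"
  shows "diff_act (var i) F = partial i F"
proof -
  let ?m = "Poly_Mapping.single i (1::nat)"
  interpret comp_fun_commute "\<lambda>j. (partial j :: ('v, 'k) mpoly \<Rightarrow> _) ^^ Poly_Mapping.lookup ?m j"
    by (rule comp_fun_commute_partial_power)
  have triv: "Finite_Set.fold (\<lambda>j. partial j ^^ Poly_Mapping.lookup ?m j) G A = G"
    if "finite A" "i \<notin> A" for A and G :: "('v, 'k) mpoly"
    using that
  proof (induction A)
    case (insert j A)
    then have "Poly_Mapping.lookup ?m j = 0"
      by (auto simp: lookup_single)
    with insert show ?case
      by (simp del: One_nat_def)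
  qed simp
  have "monom_act ?m F = (partial i ^^ Poly_Mapping.lookup ?m i)
      (Finite_Set.fold (\<lambda>j. partial j ^^ Poly_Mapping.lookup ?m j) F (UNIV - {i}))"
    unfolding monom_act_def by (rule fold_rec) auto
  then have "monom_act ?m F = (partial i ^^ 1) F"
    by (simp add: triv del: One_nat_def)
  then have "monom_act ?m F = partial i F"
    by simp
  then show ?thesis
    by (simp add: diff_act_def var_def cscale_def)
qed


section \<open>Finite closed subschemes of projective space\<close>

text \<open>Projective space is glued from the charts \<open>D\<^sub>+(y\<^sub>i)\<close>.  The ring \<open>chart_ring U\<close> is the
  degree-0 part of the localization of \<open>S\<close> at the product of the \<open>y\<^sub>i\<close> with \<open>i \<in> U\<close>: the ring of
  functions on the intersection of the charts \<open>D\<^sub>+(y\<^sub>i)\<close>, \<open>i \<in> U\<close>.\<close>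

definition chart_ring :: "'v::finite set \<Rightarrow> ('v, 'k::field) laurent set"
  where "chart_ring U = {f. \<forall>m\<in>Poly_Mapping.keys f.
    (\<Sum>i\<in>UNIV. Poly_Mapping.lookup m i) = 0 \<and> (\<forall>i. i \<notin> U \<longrightarrow> 0 \<le> Poly_Mapping.lookup m i)}"

definition ideal_of :: "'a::comm_ring_1 set \<Rightarrow> 'a set \<Rightarrow> bool"
  where "ideal_of A J \<longleftrightarrow> J \<subseteq> A \<and> 0 \<in> J \<and>
    (\<forall>f\<in>J. \<forall>g\<in>J. f + g \<in> J) \<and> (\<forall>a\<in>A. \<forall>f\<in>J. a * f \<in> J)"

text \<open>The ideal of \<open>\<Gamma>\<close> on the overlap of the charts \<open>i\<close> and \<open>j\<close>, as extension of the ideal \<open>J i\<close>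
  of \<open>\<Gamma>\<close> on the chart \<open>i\<close>.\<close>

definition overlap_ideal ::
    "('v::finite \<Rightarrow> ('v, 'k::field) laurent set) \<Rightarrow> 'v \<Rightarrow> 'v \<Rightarrow> ('v, 'k) laurent set"
  where "overlap_ideal J i j = ideal_of (chart_ring {i, j}) hull J i"

text \<open>A closed subscheme is given by its ideals on the charts, i.e. by a quasi-coherent sheaf of
  ideals: the ideals of two charts have to agree on the overlap.\<close>

definition closed_subscheme :: "('v::finite \<Rightarrow> ('v, 'k::field) laurent set) \<Rightarrow> bool"
  where "closed_subscheme J \<longleftrightarrow> (\<forall>i. ideal_of (chart_ring {i}) (J i)) \<and>
    (\<forall>i j. overlap_ideal J i j = overlap_ideal J j i)"

text \<open>\<open>\<Gamma>\<close> is finite, i.e. zero-dimensional, if the coordinate rings of its affine open pieces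
  \<open>\<Gamma> \<inter> D\<^sub>+(y\<^sub>i)\<close> are finite-dimensional over the base field.\<close>

definition finite_closed_subscheme :: "('v::finite \<Rightarrow> ('v, 'k::field) laurent set) \<Rightarrow> bool"
  where "finite_closed_subscheme J \<longleftrightarrow> closed_subscheme J \<and>
    (\<forall>i. quot_finite_dim cscale (chart_ring {i}) (J i))"

text \<open>A global section of the structure sheaf of \<open>\<Gamma>\<close> is a family of elements of the coordinate
  rings \<open>chart_ring {i} / J i\<close> that agree on overlaps.  \<open>section_reps J\<close> consists of the families
  of representatives, \<open>zero_reps J\<close> of those which represent the zero section, so that
  \<open>H\<^sup>0(\<Gamma>, O\<^sub>\<Gamma>)\<close> is the quotient of the former by the latter.\<close>

definition section_reps ::
    "('v::finite \<Rightarrow> ('v, 'k::field) laurent set) \<Rightarrow> ('v \<Rightarrow> ('v, 'k) laurent) set"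
  where "section_reps J = {s. (\<forall>i. s i \<in> chart_ring {i}) \<and>
                              (\<forall>i j. s i - s j \<in> overlap_ideal J i j)}"

definition zero_reps ::
    "('v \<Rightarrow> ('v, 'k::field) laurent set) \<Rightarrow> ('v \<Rightarrow> ('v, 'k) laurent) set"
  where "zero_reps J = {s. \<forall>i. s i \<in> J i}"

definition scheme_degree :: "('v::finite \<Rightarrow> ('v, 'k::field) laurent set) \<Rightarrow> nat"
  where "scheme_degree J = quot_dim (\<lambda>c s i. cscale c (s i)) (section_reps J) (zero_reps J)"

text \<open>\<open>dehom i t f\<close> is \<open>f\<^sub>t / y\<^sub>i\<^sup>t\<close>, where \<open>f\<^sub>t\<close> is the homogeneous component of \<open>f\<close> of degree \<open>t\<close>.\<close>

definition dehom :: "'v \<Rightarrow> nat \<Rightarrow> ('v::finite, 'k::field) mpoly \<Rightarrow> ('v, 'k) laurent"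
  where "dehom i t f = (\<Sum>m | m \<in> Poly_Mapping.keys f \<and> mdeg m = t.
    Poly_Mapping.single (Poly_Mapping.map int m - Poly_Mapping.single i (int t))
      (Poly_Mapping.lookup f m))"

text \<open>The forms of degree \<open>t\<close> in the saturated homogeneous ideal of \<open>\<Gamma>\<close> are those that vanish on
  \<open>\<Gamma>\<close>, i.e. the global sections of the ideal sheaf of \<open>\<Gamma>\<close> twisted by \<open>t\<close>.\<close>

definition homogeneous_ideal ::
    "('v::finite \<Rightarrow> ('v, 'k::field) laurent set) \<Rightarrow> ('v, 'k) mpoly set"
  where "homogeneous_ideal J = {f. \<forall>t i. dehom i t f \<in> J i}"

definition apolar :: "('v::finite \<Rightarrow> ('v, 'k::field) laurent set) \<Rightarrow> ('v, 'k) mpoly \<Rightarrow> bool"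
  where "apolar J F \<longleftrightarrow> homogeneous_ideal J \<subseteq> annihilator F"

end

(* Let I and P be the ideals of \<Gamma> and of F in S, and let h and H be the Hilbert functions of S/I and
   S/P. As S/P is finite-dimensional, the elements of degree d in P have no common zero. Over an
   infinite field, multiplication by a general one of them embeds (S/I)_t into (P/I)_(t+d), so that
   H (t + d) + h t \<le> h (t + d). Over a residue class of t modulo d this telescopes, and since
   h \<le> deg \<Gamma>, the sum of all H t is at most d * deg \<Gamma>. Over an arbitrary field, several elements of P
   together take the role of the general one. *)

theory Submission
  imports Defs
begin

section \<open>Dimensions of quotients\<close>

text \<open>Over a finite field, every form of degree d in P may vanish somewhere on \<Gamma>; then
  no single multiplication is injective on S/I. For example, F can be a constant, d = 1 and \<Gamma>
  the set of all rational points. The remedy is to replace I by the saturations I : g^infinity.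
  Modulo such an ideal multiplication by g is always injective, and the ideal is stable under all
  other multiplications. Filtering by partial intersections of these ideals, with one g for each
  layer, yields the required inequality once the full intersection is I. For this, powers of the
  variables lying in P are expressed by finitely many generators of P, which are padded to degree
  exactly d, and I is saturated. The bound h t \<le> deg \<Gamma> faces the same obstacle with
  linear forms. There the layers come from the parts of \<Gamma> on which one coordinate is
  invertible.\<close>

definition independent_mod :: "('k::field \<Rightarrow> 'b \<Rightarrow> 'b) \<Rightarrow> 'b set \<Rightarrow> 'b::ab_group_add set \<Rightarrow> bool"
  where "independent_mod scale W B \<longleftrightarrow>
    finite B \<and> (\<forall>c. (\<Sum>b\<in>B. scale (c b) b) \<in> W \<longrightarrow> (\<forall>b\<in>B. c b = 0))"

lemma independent_modD:
  "independent_mod scale W B \<Longrightarrow> (\<Sum>b\<in>B. scale (c b) b) \<in> W \<Longrightarrow> b \<in> B \<Longrightarrow> c b = 0"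
  by (auto simp: independent_mod_def)

definition spans_mod :: "('k::field \<Rightarrow> 'b \<Rightarrow> 'b) \<Rightarrow> 'b set \<Rightarrow> 'b set \<Rightarrow> 'b::ab_group_add set \<Rightarrow> bool"
  where "spans_mod scale V W B \<longleftrightarrow> (\<forall>v\<in>V. \<exists>c. v - (\<Sum>b\<in>B. scale (c b) b) \<in> W)"

context vector_space
begin

lemma finite_basis_mod_iff:
  assumes V: "subspace V" and W: "subspace W"
  shows "finite_basis_mod scale V W B \<longleftrightarrow> B \<subseteq> V \<and> independent_mod scale W B \<and> spans_mod scale V W B"
proof
  assume L: "finite_basis_mod scale V W B"
  then have fin: "finite B" and sub: "B \<subseteq> V"
    and ex1: "\<And>v. v \<in> V \<Longrightarrow> \<exists>!c. (\<forall>b. b \<notin> B \<longrightarrow> c b = 0) \<and> v - (\<Sum>b\<in>B. scale (c b) b) \<in> W"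
    by (auto simp: finite_basis_mod_def)
  have "\<forall>b\<in>B. c b = 0" if c: "(\<Sum>b\<in>B. scale (c b) b) \<in> W" for c
  proof -
    \<comment> \<open>Coefficient functions in \<open>finite_basis_mod\<close> vanish off
      \<open>B\<close>, so \<open>c'\<close> is cut off there. Then \<open>c'\<close> and the zero
      function both represent the vector 0, and uniqueness identifies them.\<close>
    define c' where "c' b = (if b \<in> B then - c b else 0)" for b
    define Q where "Q f \<longleftrightarrow> (\<forall>b. b \<notin> B \<longrightarrow> f b = 0) \<and> 0 - (\<Sum>b\<in>B. scale (f b) b) \<in> W" for f
    have "\<exists>!f. Q f"
      unfolding Q_def by (rule ex1[OF subspace_0[OF V]])
    moreover have "Q c'"
      using c by (simp add: Q_def c'_def sum_negf)
    moreover have "Q (\<lambda>_. 0)"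
      using subspace_0[OF W] by (simp add: Q_def)
    ultimately have "c' = (\<lambda>_. 0)"
      by blast
    then have "c' b = 0" for b
      by simp
    then show ?thesis
      unfolding c'_def by (metis neg_equal_0_iff_equal)
  qed
  with fin sub ex1 show "B \<subseteq> V \<and> independent_mod scale W B \<and> spans_mod scale V W B"
    unfolding independent_mod_def spans_mod_def by blast
next
  assume R: "B \<subseteq> V \<and> independent_mod scale W B \<and> spans_mod scale V W B"
  have ex1: "\<exists>!c. (\<forall>b. b \<notin> B \<longrightarrow> c b = 0) \<and> v - (\<Sum>b\<in>B. scale (c b) b) \<in> W" if "v \<in> V" for v
  proof (rule ex_ex1I)
    from R that obtain c where "v - (\<Sum>b\<in>B. scale (c b) b) \<in> W"
      by (auto simp: spans_mod_def)
    then show "\<exists>c. (\<forall>b. b \<notin> B \<longrightarrow> c b = 0) \<and> v - (\<Sum>b\<in>B. scale (c b) b) \<in> W"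
      by (intro exI[of _ "\<lambda>b. if b \<in> B then c b else 0"]) simp
  next
    fix c c'
    assume c: "(\<forall>b. b \<notin> B \<longrightarrow> c b = 0) \<and> v - (\<Sum>b\<in>B. scale (c b) b) \<in> W"
      and c': "(\<forall>b. b \<notin> B \<longrightarrow> c' b = 0) \<and> v - (\<Sum>b\<in>B. scale (c' b) b) \<in> W"
    then have "(v - (\<Sum>b\<in>B. scale (c b) b)) - (v - (\<Sum>b\<in>B. scale (c' b) b)) \<in> W"
      using subspace_diff[OF W] by blast
    then have "(\<Sum>b\<in>B. scale (c' b - c b) b) \<in> W"
      by (simp add: scale_left_diff_distrib sum_subtractf)
    then have "\<forall>b\<in>B. c' b - c b = 0"
      using R independent_modD[of scale W B "\<lambda>b. c' b - c b"] by blast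
    with c c' show "c = c'"
      by (metis eq_iff_diff_eq_0 ext)
  qed
  have "finite B" "B \<subseteq> V"
    using R by (simp_all add: independent_mod_def)
  then show "finite_basis_mod scale V W B"
    unfolding finite_basis_mod_def by (intro conjI ballI ex1)
qed

text \<open>Subtracting a linear projection onto \<open>W\<close> from the identity gives a map
  \<open>p\<close> with kernel exactly \<open>W\<close>. Relations modulo \<open>W\<close> become
  ordinary relations between images under \<open>p\<close>, where the exchange lemma
  applies.\<close>

lemma independent_mod_card_le:
  assumes W: "subspace W" and "finite B" and "spans_mod scale V W B"
    and C: "independent_mod scale W C" "C \<subseteq> V"
  shows "card C \<le> card B"
proof -
  interpret vector_space_pair scale scale by unfold_locales
  obtain g where g: "g ` UNIV \<subseteq> W" "Vector_Spaces.linear scale scale g" "\<forall>v\<in>W. g v = v"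
    using linear_exists_left_inverse_on[OF vector_space.linear_id[OF vector_space_axioms] W] by auto
  define p where "p x = x - g x" for x
  have lin: "Vector_Spaces.linear scale scale p"
    unfolding p_def using linear_compose_sub[OF vector_space.linear_ident[OF vector_space_axioms] g(2)] .
  have p0: "p x = 0 \<longleftrightarrow> x \<in> W" for x
    using g by (auto simp: p_def)
  have psum: "p (\<Sum>b\<in>A. scale (c b) b) = (\<Sum>b\<in>A. scale (c b) (p b))" for A c
    using lin by (simp add: linear_sum linear_scale)
  have finC: "finite C"
    using C by (simp add: independent_mod_def)
  have indep: "(\<Sum>b\<in>C. scale (c b) (p b)) = 0 \<Longrightarrow> \<forall>b\<in>C. c b = 0" for c
    using C psum[of c C] p0 unfolding independent_mod_def by metis
  have inj: "inj_on p C"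
  proof (rule inj_onI, rule ccontr)
    fix x y assume xy: "x \<in> C" "y \<in> C" "p x = p y" "x \<noteq> y"
    define c :: "'b \<Rightarrow> 'a" where "c b = (if b = x then 1 else if b = y then -1 else 0)" for b
    have "(\<Sum>b\<in>C. scale (c b) (p b)) = (\<Sum>b\<in>{x,y}. scale (c b) (p b))"
      using xy finC by (intro sum.mono_neutral_right) (auto simp: c_def)
    also have "\<dots> = 0"
      using xy by (simp add: c_def)
    finally have "c x = 0"
      using indep xy by blast
    then show False by (simp add: c_def)
  qed
  have "independent (p ` C)"
    unfolding independent_explicit_finite_subsets
  proof (intro allI impI ballI)
    fix A u x
    assume A: "A \<subseteq> p ` C" "finite A" and u: "(\<Sum>v\<in>A. scale (u v) v) = 0" and x: "x \<in> A"
    define c where "c b = (if p b \<in> A then u (p b) else 0)" for b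
    have "(\<Sum>b\<in>C. scale (c b) (p b)) = (\<Sum>v\<in>p ` C. scale (if v \<in> A then u v else 0) v)"
      using inj by (simp add: sum.reindex c_def)
    also have "\<dots> = (\<Sum>v\<in>A. scale (u v) v)"
      using A finC by (intro sum.mono_neutral_cong_right) auto
    finally have "\<forall>b\<in>C. c b = 0"
      using u indep by simp
    then show "u x = 0"
      using x A unfolding c_def by (metis (no_types, lifting) image_iff subsetD)
  qed
  moreover have "p ` C \<subseteq> span (p ` B)"
  proof (rule image_subsetI)
    fix x assume "x \<in> C"
    then obtain c where "x - (\<Sum>b\<in>B. scale (c b) b) \<in> W"
      using assms by (auto simp: spans_mod_def)
    then have "p x = (\<Sum>b\<in>B. scale (c b) (p b))"
      using p0 psum lin linear_diff by (metis eq_iff_diff_eq_0)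
    then show "p x \<in> span (p ` B)"
      by (simp add: span_sum span_scale span_base)
  qed
  ultimately have "card (p ` C) \<le> card (p ` B)"
    using independent_span_bound[of "p ` B" "p ` C"] \<open>finite B\<close> by simp
  also have "\<dots> \<le> card B"
    using \<open>finite B\<close> by (rule card_image_le)
  finally show ?thesis
    using inj by (simp add: card_image)
qed

lemma finite_basis_mod_card:
  assumes "subspace V" "subspace W" "finite_basis_mod scale V W B"
  shows "quot_dim scale V W = card B"
  unfolding quot_dim_def
proof (rule the_equality)
  fix n assume "\<exists>B. finite_basis_mod scale V W B \<and> card B = n"
  then obtain B' where "finite_basis_mod scale V W B'" "card B' = n"
    by auto
  with assms show "n = card B"
    using independent_mod_card_le[of W B V B'] independent_mod_card_le[of W B' V B]
    by (auto simp: finite_basis_mod_iff independent_mod_def)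
qed (use assms in auto)

lemma card_le_quot_dim:
  assumes "subspace V" "subspace W" "quot_finite_dim scale V W"
    and "independent_mod scale W C" "C \<subseteq> V"
  shows "card C \<le> quot_dim scale V W"
proof -
  obtain B where B: "finite_basis_mod scale V W B"
    using assms(3) by (auto simp: quot_finite_dim_def)
  then have "finite B" "spans_mod scale V W B"
    using assms(1,2) by (simp_all add: finite_basis_mod_iff independent_mod_def)
  then have "card C \<le> card B"
    using independent_mod_card_le assms by blast
  then show ?thesis
    using finite_basis_mod_card[OF assms(1,2) B] by simp
qed

text \<open>A bound on the sizes of independent sets makes one of maximal size exist, and that one
  is a basis. Finite dimension and the estimate thus come together, and comparisons of quotients
  only have to transport independent sets.\<close>

lemma quot_dim_leI:
  assumes V: "subspace V" and W: "subspace W"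
    and bound: "\<And>C. independent_mod scale W C \<Longrightarrow> C \<subseteq> V \<Longrightarrow> card C \<le> n"
  shows "quot_finite_dim scale V W" "quot_dim scale V W \<le> n"
proof -
  let ?P = "\<lambda>C. independent_mod scale W C \<and> C \<subseteq> V"
  have "?P {}"
    by (simp add: independent_mod_def)
  moreover have "\<forall>C. ?P C \<longrightarrow> card C < Suc n"
    using bound by (auto simp: less_Suc_eq_le)
  ultimately obtain B where B: "?P B" and max: "\<And>C. ?P C \<Longrightarrow> card C \<le> card B"
    using Lattices_Big.ex_has_greatest_nat[of ?P "{}" card "Suc n"] by blast
  have finB: "finite B"
    using B by (simp add: independent_mod_def)
  have "\<exists>c. v - (\<Sum>b\<in>B. scale (c b) b) \<in> W" if "v \<in> V" for v
  \<comment> \<open>Maximality says something only if \<open>insert v B\<close> is larger than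
    \<open>B\<close>.\<close>
  proof (cases "v \<in> B")
    case True
    have "(\<Sum>b\<in>B. scale (if b = v then 1 else 0) b) = (\<Sum>b\<in>B. if b = v then b else 0)"
      by (intro sum.cong) auto
    then have "v - (\<Sum>b\<in>B. scale (if b = v then 1 else 0) b) \<in> W"
      using True finB subspace_0[OF W] by simp
    then show ?thesis
      by (rule exI[of _ "\<lambda>b. if b = v then 1 else 0"])
  next
    case False
    then have "card (insert v B) > card B"
      using finB by simp
    then have "\<not> independent_mod scale W (insert v B)"
      using max[of "insert v B"] B that by auto
    then obtain c b where c: "(\<Sum>b\<in>insert v B. scale (c b) b) \<in> W" and b: "b \<in> insert v B" "c b \<noteq> 0"
      using finB by (auto simp: independent_mod_def)
    have cv: "c v \<noteq> 0"
    proof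
      assume "c v = 0"
      then have "(\<Sum>b\<in>B. scale (c b) b) \<in> W"
        using c False finB by simp
      then have "\<forall>b\<in>B. c b = 0"
        using B unfolding independent_mod_def by blast
      with b \<open>c v = 0\<close> show False by auto
    qed
    have "scale (inverse (c v)) (scale (c v) v + (\<Sum>b\<in>B. scale (c b) b)) \<in> W"
      using c False finB subspace_scale[OF W] by simp
    then have "v - (\<Sum>b\<in>B. scale (- (inverse (c v) * c b)) b) \<in> W"
      using cv by (simp add: scale_right_distrib scale_sum_right sum_negf)
    then show ?thesis
      by (rule exI[of _ "\<lambda>b. - (inverse (c v) * c b)"])
  qed
  then have "finite_basis_mod scale V W B"
    using B V W by (simp add: finite_basis_mod_iff spans_mod_def)
  then show "quot_finite_dim scale V W" "quot_dim scale V W \<le> n"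
    using bound[of B] B finite_basis_mod_card[OF V W, of B] unfolding quot_finite_dim_def by auto
qed

lemma quot_dim_trivial:
  assumes "subspace V" "subspace W" "V \<subseteq> W"
  shows "quot_finite_dim scale V W" "quot_dim scale V W = 0"
proof -
  have *: "card C \<le> 0" if "independent_mod scale W C" "C \<subseteq> V" for C
  proof -
    have "(\<Sum>b\<in>C. scale ((\<lambda>_. 1) b) b) \<in> W"
      using that assms by (intro subspace_sum) (auto intro: subspace_scale)
    then have "b \<notin> C" for b
      using independent_modD[OF that(1), of "\<lambda>_. 1" b] by auto
    then have "C = {}" by blast
    then show ?thesis by simp
  qed
  show "quot_finite_dim scale V W" "quot_dim scale V W = 0"
    using quot_dim_leI[OF assms(1,2) *] by auto
qed

lemma quot_dim_mono:
  assumes "subspace V" "subspace W" "subspace V'" "subspace W'" "quot_finite_dim scale V W"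
    and "V' \<subseteq> V" "W \<subseteq> W'"
  shows "quot_finite_dim scale V' W'" "quot_dim scale V' W' \<le> quot_dim scale V W"
proof -
  have *: "card C \<le> quot_dim scale V W" if "independent_mod scale W' C" "C \<subseteq> V'" for C
  proof (rule card_le_quot_dim)
    show "independent_mod scale W C"
      using that(1) \<open>W \<subseteq> W'\<close> unfolding independent_mod_def by blast
  qed (use assms that in auto)
  show "quot_finite_dim scale V' W'" "quot_dim scale V' W' \<le> quot_dim scale V W"
    using quot_dim_leI[OF \<open>subspace V'\<close> \<open>subspace W'\<close> *] by auto
qed

lemma quot_dim_add:
  assumes V: "subspace V" and U: "subspace U" and W: "subspace W" and "W \<subseteq> U" "U \<subseteq> V"
    and fVU: "quot_finite_dim scale V U" and fUW: "quot_finite_dim scale U W"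
  shows "quot_finite_dim scale V W"
    and "quot_dim scale V W = quot_dim scale V U + quot_dim scale U W"
proof -
  obtain A B where A: "finite_basis_mod scale V U A" and B: "finite_basis_mod scale U W B"
    using fVU fUW by (auto simp: quot_finite_dim_def)
  then have fin: "finite A" "finite B" and A': "A \<subseteq> V" "independent_mod scale U A" "spans_mod scale V U A"
    and B': "B \<subseteq> U" "independent_mod scale W B" "spans_mod scale U W B"
    using V U W by (auto simp: finite_basis_mod_iff independent_mod_def)
  \<comment> \<open>A common element would be zero modulo \<open>U\<close>, since \<open>B\<close>
    lies in \<open>U\<close>, and nonzero modulo \<open>U\<close> as a member of \<open>A\<close>.
    Disjointness makes the cardinalities add.\<close>
  have disj: "A \<inter> B = {}"
  proof (rule ccontr)
    assume "A \<inter> B \<noteq> {}"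
    then obtain a where a: "a \<in> A" "a \<in> B" by auto
    have "(\<Sum>b\<in>A. scale (if b = a then 1 else 0) b) = (\<Sum>b\<in>A. if b = a then b else 0)"
      by (intro sum.cong) auto
    then have "(\<Sum>b\<in>A. scale ((\<lambda>b. if b = a then 1 else 0) b) b) \<in> U"
      using a B' fin by auto
    from independent_modD[OF A'(2) this a(1)] show False by simp
  qed
  have "independent_mod scale W (A \<union> B)"
    unfolding independent_mod_def
  proof (intro conjI allI impI)
    fix c assume c: "(\<Sum>b\<in>A \<union> B. scale (c b) b) \<in> W"
    have sumB: "(\<Sum>b\<in>B. scale (c b) b) \<in> U"
      using B' U by (intro subspace_sum) (auto intro: subspace_scale)
    have eq: "(\<Sum>b\<in>A \<union> B. scale (c b) b) = (\<Sum>b\<in>A. scale (c b) b) + (\<Sum>b\<in>B. scale (c b) b)"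
      using fin disj by (intro sum.union_disjoint) auto
    have "(\<Sum>b\<in>A. scale (c b) b) \<in> U"
      using subspace_diff[OF U _ sumB, of "\<Sum>b\<in>A \<union> B. scale (c b) b"] c \<open>W \<subseteq> U\<close> eq by auto
    then have cA: "\<forall>b\<in>A. c b = 0"
      using A'(2) unfolding independent_mod_def by blast
    with c eq have "(\<Sum>b\<in>B. scale (c b) b) \<in> W"
      by simp
    then have "\<forall>b\<in>B. c b = 0"
      using B'(2) unfolding independent_mod_def by blast
    with cA show "\<forall>b\<in>A \<union> B. c b = 0" by auto
  qed (use fin in auto)
  moreover have "spans_mod scale V W (A \<union> B)"
    unfolding spans_mod_def
  proof
    fix v assume "v \<in> V"
    then obtain c where c: "v - (\<Sum>b\<in>A. scale (c b) b) \<in> U"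
      using A' by (auto simp: spans_mod_def)
    then obtain c' where c': "v - (\<Sum>b\<in>A. scale (c b) b) - (\<Sum>b\<in>B. scale (c' b) b) \<in> W"
      using B' by (auto simp: spans_mod_def)
    define c'' where "c'' b = (if b \<in> A then c b else c' b)" for b
    have "(\<Sum>b\<in>A \<union> B. scale (c'' b) b) = (\<Sum>b\<in>A. scale (c'' b) b) + (\<Sum>b\<in>B. scale (c'' b) b)"
      using fin disj by (intro sum.union_disjoint) auto
    also have "(\<Sum>b\<in>A. scale (c'' b) b) = (\<Sum>b\<in>A. scale (c b) b)"
      by (simp add: c''_def)
    also have "(\<Sum>b\<in>B. scale (c'' b) b) = (\<Sum>b\<in>B. scale (c' b) b)"
      using disj by (intro sum.cong) (auto simp: c''_def)
    finally show "\<exists>c. v - (\<Sum>b\<in>A \<union> B. scale (c b) b) \<in> W"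
      using c' by (intro exI[of _ c'']) (simp add: algebra_simps)
  qed
  ultimately have "finite_basis_mod scale V W (A \<union> B)"
    using A' B' V W \<open>U \<subseteq> V\<close> by (auto simp: finite_basis_mod_iff)
  then show "quot_finite_dim scale V W"
    and "quot_dim scale V W = quot_dim scale V U + quot_dim scale U W"
    using finite_basis_mod_card[OF V U A] finite_basis_mod_card[OF U W B]
      finite_basis_mod_card[OF V W, of "A \<union> B"] card_Un_disjoint[OF fin disj]
    unfolding quot_finite_dim_def by auto
qed

end

section \<open>Comparing quotients along linear maps\<close>

lemma quot_dim_inj:
  assumes "Vector_Spaces.linear s1 s2 \<phi>"
    and V: "module.subspace s1 V" and N: "module.subspace s1 N"
    and U: "module.subspace s2 U" and K: "module.subspace s2 K"
    and fd: "quot_finite_dim s2 U K"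
    and maps: "\<And>v. v \<in> V \<Longrightarrow> \<phi> v \<in> U" and ker: "\<And>v. v \<in> V \<Longrightarrow> \<phi> v \<in> K \<Longrightarrow> v \<in> N"
  shows "quot_finite_dim s1 V N" "quot_dim s1 V N \<le> quot_dim s2 U K"
proof -
  interpret Vector_Spaces.linear s1 s2 \<phi> by fact
  have *: "card C \<le> quot_dim s2 U K" if C: "independent_mod s1 N C" "C \<subseteq> V" for C
  proof -
    have finC: "finite C"
      using C by (simp add: independent_mod_def)
    \<comment> \<open>A relation modulo \<open>K\<close> between the images is the image of a
      combination in \<open>V\<close>, which \<open>ker\<close> puts into \<open>N\<close>.\<close>
    have indep: "\<forall>b\<in>C. c b = 0" if "(\<Sum>b\<in>C. s2 (c b) (\<phi> b)) \<in> K" for c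
    proof -
      have "(\<Sum>b\<in>C. s1 (c b) b) \<in> V"
        using C V by (intro vs1.subspace_sum) (auto intro: vs1.subspace_scale)
      moreover have "\<phi> (\<Sum>b\<in>C. s1 (c b) b) \<in> K"
        using that by (simp add: sum scale)
      ultimately show ?thesis
        using ker C unfolding independent_mod_def by blast
    qed
    have inj: "inj_on \<phi> C"
    proof (rule inj_onI, rule ccontr)
      fix x y assume xy: "x \<in> C" "y \<in> C" "\<phi> x = \<phi> y" "x \<noteq> y"
      define c :: "_ \<Rightarrow> 'a" where "c b = (if b = x then 1 else if b = y then -1 else 0)" for b
      have "(\<Sum>b\<in>C. s2 (c b) (\<phi> b)) = (\<Sum>b\<in>{x,y}. s2 (c b) (\<phi> b))"
        using xy finC by (intro sum.mono_neutral_right) (auto simp: c_def)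
      also have "\<dots> = 0"
        using xy by (simp add: c_def)
      finally have "c x = 0"
        using indep xy vs2.subspace_0[OF K] by simp
      then show False by (simp add: c_def)
    qed
    have "independent_mod s2 K (\<phi> ` C)"
      unfolding independent_mod_def
    proof (intro conjI allI impI)
      fix c assume "(\<Sum>b\<in>\<phi> ` C. s2 (c b) b) \<in> K"
      then show "\<forall>b\<in>\<phi> ` C. c b = 0"
        using indep[of "\<lambda>b. c (\<phi> b)"] inj by (simp add: sum.reindex)
    qed (use finC in simp)
    then have "card (\<phi> ` C) \<le> quot_dim s2 U K"
      using vs2.card_le_quot_dim[OF U K fd] C maps by auto
    then show ?thesis
      using inj by (simp add: card_image)
  qed
  show "quot_finite_dim s1 V N" "quot_dim s1 V N \<le> quot_dim s2 U K"
    using vs1.quot_dim_leI[OF V N *] by auto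
qed

text \<open>If no single linear map detects the subspace \<open>\<Inter>i. N i\<close>, several maps \<open>\<phi> i\<close> may do so
  jointly, each of them embedding one layer of the filtration of \<open>V\<close> by the partial intersections of
  the \<open>N i\<close> into the corresponding layer of \<open>U\<close>.\<close>

lemma quot_dim_joint_inj:
  fixes s1 :: "'k::field \<Rightarrow> 'b::ab_group_add \<Rightarrow> 'b" and s2 :: "'k \<Rightarrow> 'c::ab_group_add \<Rightarrow> 'c"
    and \<phi> :: "'i \<Rightarrow> 'b \<Rightarrow> 'c"
  assumes vs1: "vector_space s1" and vs2: "vector_space s2"
    and "finite A"
    and lin: "\<And>i. i \<in> A \<Longrightarrow> Vector_Spaces.linear s1 s2 (\<phi> i)"
    and N: "\<And>i. i \<in> A \<Longrightarrow> module.subspace s1 (N i)"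
    and K: "\<And>i. i \<in> A \<Longrightarrow> module.subspace s2 (K i)"
    and V: "module.subspace s1 V" and U: "module.subspace s2 U"
    and maps: "\<And>i v. i \<in> A \<Longrightarrow> v \<in> V \<Longrightarrow> \<phi> i v \<in> U"
    and ker: "\<And>i v. i \<in> A \<Longrightarrow> v \<in> V \<Longrightarrow> \<phi> i v \<in> K i \<Longrightarrow> v \<in> N i"
    and inv: "\<And>i j v. i \<in> A \<Longrightarrow> j \<in> A \<Longrightarrow> v \<in> V \<Longrightarrow> v \<in> N i \<Longrightarrow> \<phi> j v \<in> K i"
    and fd: "quot_finite_dim s2 U (U \<inter> (\<Inter>i\<in>A. K i))"
  shows "quot_finite_dim s1 V (V \<inter> (\<Inter>i\<in>A. N i)) \<and>
    quot_dim s1 V (V \<inter> (\<Inter>i\<in>A. N i)) \<le> quot_dim s2 U (U \<inter> (\<Inter>i\<in>A. K i))"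
proof -
  interpret vs1: vector_space s1 by fact
  interpret vs2: vector_space s2 by fact
  show ?thesis
    using \<open>finite A\<close> lin N K V U maps ker inv fd
  proof (induction A arbitrary: V U)
    case empty
    then show ?case
      by (simp add: vs1.quot_dim_trivial)
  next
    case (insert a A)
    let ?V = "V \<inter> N a" and ?U = "U \<inter> K a"
    let ?V' = "?V \<inter> (\<Inter>i\<in>A. N i)" and ?U' = "?U \<inter> (\<Inter>i\<in>A. K i)"
    have sub: "vs1.subspace ?V" "vs2.subspace ?U"
      using insert.prems by (auto intro: vs1.subspace_inter vs2.subspace_inter)
    have sub': "vs1.subspace ?V'" "vs2.subspace ?U'"
      using sub insert.prems by (auto intro!: vs1.subspace_inter vs2.subspace_inter vs1.subspace_Int vs2.subspace_Int)
    have U'_eq: "U \<inter> (\<Inter>i\<in>insert a A. K i) = ?U'" and V'_eq: "V \<inter> (\<Inter>i\<in>insert a A. N i) = ?V'"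
      by auto
    have fd: "quot_finite_dim s2 U ?U'"
      using insert.prems(9) unfolding U'_eq .
    have fdU: "quot_finite_dim s2 U ?U" "quot_finite_dim s2 ?U ?U'"
      using vs2.quot_dim_mono(1)[OF insert.prems(5) sub'(2) _ _ fd] sub insert.prems(5) sub' by auto
    \<comment> \<open>By \<open>inv\<close>, every remaining \<open>\<phi> j\<close> sends
      \<open>?V\<close> into \<open>?U\<close>, so these maps restrict to the lower layers. The top
      layer is left to \<open>\<phi> a\<close>.\<close>
    have IH: "quot_finite_dim s1 ?V ?V' \<and> quot_dim s1 ?V ?V' \<le> quot_dim s2 ?U ?U'"
      by (rule insert.IH) (use insert.prems sub fdU in auto)
    have step: "quot_finite_dim s1 V ?V" "quot_dim s1 V ?V \<le> quot_dim s2 U ?U"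
      using quot_dim_inj[OF insert.prems(1)[of a] insert.prems(4) sub(1) insert.prems(5) sub(2) fdU(1)]
        insert.prems(6,7) by auto
    have subs: "?V' \<subseteq> ?V" "?V \<subseteq> V" "?U' \<subseteq> ?U" "?U \<subseteq> U"
      by auto
    show ?case
      unfolding U'_eq V'_eq
      using vs1.quot_dim_add[OF insert.prems(4) sub(1) sub'(1) subs(1,2) step(1) conjunct1[OF IH]]
        vs2.quot_dim_add[OF insert.prems(5) sub(2) sub'(2) subs(3,4) fdU] step(2) IH
      by linarith
  qed
qed

text \<open>The maps \<open>\<phi> i\<close> together embed the quotient into the product of the
  quotients of \<open>U i\<close> by \<open>K i\<close>; imposing the conditions one at a time gives
  the sum. The subspace claim is carried along because the induction feeds it to
  \<open>quot_dim_add\<close>.\<close>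

lemma quot_dim_filtration:
  fixes s1 :: "'k::field \<Rightarrow> 'b::ab_group_add \<Rightarrow> 'b" and s2 :: "'k \<Rightarrow> 'c::ab_group_add \<Rightarrow> 'c"
    and \<phi> :: "'i \<Rightarrow> 'b \<Rightarrow> 'c"
  assumes vs1: "vector_space s1" and vs2: "vector_space s2"
    and "finite A"
    and lin: "\<And>i. i \<in> A \<Longrightarrow> Vector_Spaces.linear s1 s2 (\<phi> i)"
    and V: "module.subspace s1 V"
    and U: "\<And>i. i \<in> A \<Longrightarrow> module.subspace s2 (U i)"
    and K: "\<And>i. i \<in> A \<Longrightarrow> module.subspace s2 (K i)"
    and maps: "\<And>i v. i \<in> A \<Longrightarrow> v \<in> V \<Longrightarrow> \<phi> i v \<in> U i"
    and fd: "\<And>i. i \<in> A \<Longrightarrow> quot_finite_dim s2 (U i) (K i)"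
  shows "module.subspace s1 {v \<in> V. \<forall>i\<in>A. \<phi> i v \<in> K i} \<and>
    quot_finite_dim s1 V {v \<in> V. \<forall>i\<in>A. \<phi> i v \<in> K i} \<and>
    quot_dim s1 V {v \<in> V. \<forall>i\<in>A. \<phi> i v \<in> K i} \<le> (\<Sum>i\<in>A. quot_dim s2 (U i) (K i))"
proof -
  interpret vs1: vector_space s1 by fact
  interpret vs2: vector_space s2 by fact
  show ?thesis
    using \<open>finite A\<close> lin U K maps fd
  proof (induction A)
    case empty
    then show ?case
      using V by (simp add: vs1.quot_dim_trivial)
  next
    case (insert a A)
    let ?V = "{v \<in> V. \<forall>i\<in>A. \<phi> i v \<in> K i}" and ?V' = "{v \<in> V. \<forall>i\<in>insert a A. \<phi> i v \<in> K i}"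
    have IH: "vs1.subspace ?V" "quot_finite_dim s1 V ?V"
        "quot_dim s1 V ?V \<le> (\<Sum>i\<in>A. quot_dim s2 (U i) (K i))"
      using insert by auto
    have "vs1.subspace (\<phi> a -` K a)"
      using module_hom.subspace_vimage[OF module_hom_linearI[OF insert.prems(1)] insert.prems(3)] by simp
    moreover have V'_eq: "?V' = ?V \<inter> \<phi> a -` K a"
      by auto
    ultimately have sub: "vs1.subspace ?V'"
      using IH(1) vs1.subspace_inter by auto
    have "quot_finite_dim s1 ?V ?V'" "quot_dim s1 ?V ?V' \<le> quot_dim s2 (U a) (K a)"
      using quot_dim_inj[OF insert.prems(1)[of a] IH(1) sub insert.prems(2)[of a] insert.prems(3)[of a]
          insert.prems(5)[of a]] insert.prems(4) by auto
    then have "quot_finite_dim s1 V ?V'" "quot_dim s1 V ?V' \<le> (\<Sum>i\<in>insert a A. quot_dim s2 (U i) (K i))"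
      using vs1.quot_dim_add[OF V IH(1) sub _ _ IH(2)] IH(3) insert.hyps by (auto simp: Collect_mono)
    with sub show ?case by blast
  qed
qed

section \<open>Polynomials and charts\<close>

lemma poly_mapping_sum_single:
  fixes f :: "'a \<Rightarrow>\<^sub>0 'b::comm_monoid_add"
  shows "(\<Sum>m\<in>Poly_Mapping.keys f. Poly_Mapping.single m (Poly_Mapping.lookup f m)) = f"
  by (rule poly_mapping_eqI) (auto simp: lookup_sum lookup_single when_def in_keys_iff)

lemma poly_mapping_monomial_induct [case_names single add]:
  fixes f :: "'a \<Rightarrow>\<^sub>0 'b::comm_monoid_add"
  assumes "\<And>m c. P (Poly_Mapping.single m c)" and "\<And>f g. P f \<Longrightarrow> P g \<Longrightarrow> P (f + g)"
  shows "P f"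
proof -
  have "P (\<Sum>m\<in>A. Poly_Mapping.single m (Poly_Mapping.lookup f m))" if "finite A" for A
    using that
  proof (induction A)
    case empty
    show ?case using assms(1)[of undefined 0] by simp
  qed (use assms in simp)
  from this[OF finite_keys, of f] show ?thesis
    by (simp add: poly_mapping_sum_single)
qed

lemma vector_space_cscale: "vector_space (cscale :: 'k::field \<Rightarrow> ('a::comm_monoid_add \<Rightarrow>\<^sub>0 'k) \<Rightarrow> _)"
  by unfold_locales
    (simp_all add: cscale_def distrib_left single_add distrib_right mult_single flip: mult.assoc)

lemma vector_space_families:
  "vector_space (\<lambda>c (s :: 'v \<Rightarrow> ('a::comm_monoid_add \<Rightarrow>\<^sub>0 'k::field)) i. cscale c (s i))"
proof -
  interpret vector_space "cscale :: 'k \<Rightarrow> ('a \<Rightarrow>\<^sub>0 'k) \<Rightarrow> _" by (rule vector_space_cscale)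
  show ?thesis
    by unfold_locales (auto simp: fun_eq_iff scale_right_distrib scale_left_distrib)
qed

lemma cscale_times_right: "cscale c (f * g) = f * cscale c (g :: ('a::comm_monoid_add \<Rightarrow>\<^sub>0 'k::field))"
  by (simp add: cscale_def mult.left_commute)

lemma form_times:
  assumes "form a f" "form b g"
  shows "form (a + b) (f * g)"
  using assms keys_mult[of f g] unfolding form_def mdeg_def
  by (fastforce simp: lookup_add sum.distrib)

lemma form_add: "form a f \<Longrightarrow> form a g \<Longrightarrow> form a (f + g)"
  using keys_add[of f g] unfolding form_def by blast

lemma form_0 [simp]: "form a 0"
  by (simp add: form_def)

lemma mdeg_zero [simp]: "mdeg 0 = 0"
  by (simp add: mdeg_def)

lemma mdeg_single [simp]: "mdeg (Poly_Mapping.single i n) = n"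
  by (simp add: mdeg_def lookup_single when_def)

lemma mdeg_add: "mdeg (m + m') = mdeg m + mdeg m'"
  by (simp add: mdeg_def lookup_add sum.distrib)

lemma form_single: "form (mdeg m) (Poly_Mapping.single m c)"
  by (simp add: form_def)

lemma form_cscale: "form a f \<Longrightarrow> form a (cscale c f)"
  using form_times[of 0 "Poly_Mapping.single 0 c" a f] form_single[of 0 c] by (simp add: cscale_def)

lemma subspace_forms: "module.subspace cscale {f. form t f}"
proof -
  interpret vector_space cscale by (rule vector_space_cscale)
  show ?thesis
    by (auto simp: subspace_def form_add form_cscale)
qed

section \<open>Homogeneous components and dehomogenization\<close>

definition hom_part :: "nat \<Rightarrow> ('v::finite, 'k::field) mpoly \<Rightarrow> ('v, 'k) mpoly"
  where "hom_part t f = (\<Sum>m\<in>Poly_Mapping.keys f.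
    if mdeg m = t then Poly_Mapping.single m (Poly_Mapping.lookup f m) else 0)"

lemma hom_part_add: "hom_part t (f + g) = hom_part t f + hom_part t g"
  unfolding hom_part_def
  by (rule setsum_keys_plus_distrib) (auto simp: single_add)

lemma hom_part_single: "hom_part t (Poly_Mapping.single m c) = (if mdeg m = t then Poly_Mapping.single m c else 0)"
  by (simp add: hom_part_def)

lemma hom_part_cscale: "hom_part t (cscale c f) = cscale c (hom_part t f)"
  by (induction f rule: poly_mapping_monomial_induct)
    (simp_all add: cscale_def distrib_left hom_part_add mult_single hom_part_single)

lemma form_hom_part: "form t (hom_part t f)"
proof (induction f rule: poly_mapping_monomial_induct)
  case (single m c)
  then show ?case using form_single[of m c] by (auto simp: hom_part_single)
qed (simp add: hom_part_add form_add)

text \<open>Claiming equality for all large \<open>n\<close> lets the thresholds of two summands be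
  merged by their maximum.\<close>

lemma finite_sum_hom_part: "\<exists>n0. \<forall>n\<ge>n0. (\<Sum>t<n. hom_part t f) = f"
proof (induction f rule: poly_mapping_monomial_induct)
  case (single m c)
  show ?case by (rule exI[of _ "Suc (mdeg m)"]) (auto simp: hom_part_single)
next
  case (add f g)
  then obtain a b where "\<forall>n\<ge>a. (\<Sum>t<n. hom_part t f) = f" "\<forall>n\<ge>b. (\<Sum>t<n. hom_part t g) = g"
    by auto
  then show ?case
    by (intro exI[of _ "max a b"]) (simp add: hom_part_add sum.distrib)
qed

lemma dehom_add: "dehom i t (f + g) = dehom i t f + dehom i t g"
proof -
  \<comment> \<open>Moving the degree condition from the index set into the summand makes the
    additivity rule for sums over \<open>keys\<close> applicable.\<close>
  have *: "dehom i t f = (\<Sum>m\<in>Poly_Mapping.keys f. if mdeg m = t then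
      Poly_Mapping.single (Poly_Mapping.map int m - Poly_Mapping.single i (int t)) (Poly_Mapping.lookup f m) else 0)"
    for f
    unfolding dehom_def by (simp add: sum.If_cases Collect_conj_eq)
  show ?thesis
    unfolding * by (rule setsum_keys_plus_distrib) (auto simp: single_add)
qed

lemma dehom_single:
  "dehom i t (Poly_Mapping.single m c) = (if mdeg m = t then
    Poly_Mapping.single (Poly_Mapping.map int m - Poly_Mapping.single i (int t)) c else 0)"
proof -
  have "{m'. m' \<in> (if c = 0 then {} else {m}) \<and> mdeg m' = t} = (if c = 0 \<or> mdeg m \<noteq> t then {} else {m})"
    by auto
  then show ?thesis
    by (simp add: dehom_def)
qed

lemma lookup_map_int: "Poly_Mapping.lookup (Poly_Mapping.map int m) i = int (Poly_Mapping.lookup m i)"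
  by (simp add: map.rep_eq when_def)

lemma map_int_0: "Poly_Mapping.map int 0 = 0"
  by (simp add: map_eq_zero_iff)

lemma dehom_monomial_times:
  "dehom i (t + mdeg m) (Poly_Mapping.single m c * f) =
    Poly_Mapping.single (Poly_Mapping.map int m - Poly_Mapping.single i (int (mdeg m))) c * dehom i t f"
proof (induction f rule: poly_mapping_monomial_induct)
  case (single m' c')
  have "Poly_Mapping.map int (m + m') - Poly_Mapping.single i (int (t + mdeg m)) =
    (Poly_Mapping.map int m - Poly_Mapping.single i (int (mdeg m))) +
    (Poly_Mapping.map int m' - Poly_Mapping.single i (int t))"
    by (rule poly_mapping_eqI) (simp add: lookup_minus lookup_add lookup_map_int lookup_single when_def)
  then show ?case
    by (simp add: mult_single dehom_single mdeg_add add.commute)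
qed (simp add: distrib_left dehom_add)

lemma dehom_monomial_times_low:
  "t < mdeg m \<Longrightarrow> dehom i t (Poly_Mapping.single m c * f) = 0"
  by (induction f rule: poly_mapping_monomial_induct)
    (auto simp: distrib_left dehom_add mult_single dehom_single mdeg_add)

lemma dehom_cscale: "dehom i t (cscale c f) = cscale c (dehom i t f)"
  using dehom_monomial_times[of i t 0 c f] by (simp add: cscale_def map_int_0)

lemma dehom_form_other:
  assumes "form e f" "t \<noteq> e"
  shows "dehom i t f = 0"
proof -
  have "{m. m \<in> Poly_Mapping.keys f \<and> mdeg m = t} = {}"
    using assms by (auto simp: form_def)
  then show ?thesis by (simp only: dehom_def sum.empty)
qed

text \<open>\<open>chart_quot j i\<close> is the coordinate function \<open>y\<^sub>i / y\<^sub>j\<close> on the chart \<open>D\<^sub>+(y\<^sub>j)\<close>.\<close>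

definition chart_quot :: "'v \<Rightarrow> 'v \<Rightarrow> ('v::finite, 'k::field) laurent"
  where "chart_quot j i = Poly_Mapping.single (Poly_Mapping.single i 1 - Poly_Mapping.single j 1) 1"

lemma chart_quot_self [simp]: "chart_quot j j = 1"
  by (simp add: chart_quot_def)

lemma chart_quot_times: "chart_quot j i * chart_quot k j = chart_quot k i"
  by (simp add: chart_quot_def mult_single)

lemma chart_quot_power:
  "chart_quot j i ^ n = Poly_Mapping.single (Poly_Mapping.single i (int n) - Poly_Mapping.single j (int n)) 1"
  by (induction n) (auto simp: chart_quot_def mult_single algebra_simps single_add)

text \<open>The factor is the transition function of the twisting sheaf O(t) between the charts
  \<open>j\<close> and \<open>k\<close>.\<close>

lemma dehom_change_chart: "dehom k t f = chart_quot k j ^ t * dehom j t f"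
proof (induction f rule: poly_mapping_monomial_induct)
  case (single m c)
  then show ?case
    by (simp add: dehom_single chart_quot_power mult_single)
qed (simp add: dehom_add distrib_left)

lemma chart_ring_single_iff:
  "c \<noteq> 0 \<Longrightarrow> Poly_Mapping.single m c \<in> chart_ring U \<longleftrightarrow>
    (\<Sum>i\<in>UNIV. Poly_Mapping.lookup m i) = 0 \<and> (\<forall>i. i \<notin> U \<longrightarrow> 0 \<le> Poly_Mapping.lookup m i)"
  by (simp add: chart_ring_def)

lemma chart_ring_0 [simp]: "0 \<in> chart_ring U"
  by (simp add: chart_ring_def)

lemma chart_ring_const [simp]: "Poly_Mapping.single 0 c \<in> chart_ring U"
  by (simp add: chart_ring_def)

lemma chart_ring_1 [simp]: "1 \<in> chart_ring U"
  by (simp add: chart_ring_def)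

lemma chart_ring_add: "f \<in> chart_ring U \<Longrightarrow> g \<in> chart_ring U \<Longrightarrow> f + g \<in> chart_ring U"
  using keys_add[of f g] unfolding chart_ring_def by blast

lemma chart_ring_mult:
  assumes "f \<in> chart_ring U" "g \<in> chart_ring U"
  shows "f * g \<in> chart_ring U"
  unfolding chart_ring_def
proof (clarify, intro conjI allI impI)
  fix m assume "m \<in> Poly_Mapping.keys (f * g)"
  then obtain a b where m: "m = a + b" and ab: "a \<in> Poly_Mapping.keys f" "b \<in> Poly_Mapping.keys g"
    using keys_mult[of f g] by blast
  have a: "(\<Sum>i\<in>UNIV. Poly_Mapping.lookup a i) = 0" "\<And>i. i \<notin> U \<Longrightarrow> 0 \<le> Poly_Mapping.lookup a i"
    and b: "(\<Sum>i\<in>UNIV. Poly_Mapping.lookup b i) = 0" "\<And>i. i \<notin> U \<Longrightarrow> 0 \<le> Poly_Mapping.lookup b i"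
    using assms ab by (auto simp: chart_ring_def)
  show "(\<Sum>i\<in>UNIV. Poly_Mapping.lookup m i) = 0"
    using a b by (simp add: m lookup_add sum.distrib)
  show "0 \<le> Poly_Mapping.lookup m i" if "i \<notin> U" for i
    using a(2)[OF that] b(2)[OF that] by (simp add: m lookup_add)
qed

lemma chart_ring_cscale: "f \<in> chart_ring U \<Longrightarrow> cscale c f \<in> chart_ring U"
  by (simp add: cscale_def chart_ring_mult)

lemma chart_ring_uminus: "f \<in> chart_ring U \<Longrightarrow> - f \<in> chart_ring U"
  by (simp add: chart_ring_def)

lemma chart_ring_power: "f \<in> chart_ring U \<Longrightarrow> f ^ n \<in> chart_ring U"
  by (induction n) (simp_all add: chart_ring_mult)

lemma chart_ring_sum: "(\<And>x. x \<in> A \<Longrightarrow> f x \<in> chart_ring U) \<Longrightarrow> sum f A \<in> chart_ring U"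
  by (induction A rule: infinite_finite_induct) (simp_all add: chart_ring_add)

lemma chart_ring_mono: "U \<subseteq> U' \<Longrightarrow> chart_ring U \<subseteq> chart_ring U'"
  by (auto simp: chart_ring_def)

lemma subspace_chart_ring: "module.subspace cscale (chart_ring U)"
proof -
  interpret vector_space cscale by (rule vector_space_cscale)
  show ?thesis
    by (simp add: subspace_def chart_ring_add chart_ring_cscale)
qed

lemma chart_quot_in_chart_ring: "j \<in> U \<Longrightarrow> chart_quot j i \<in> chart_ring U"
  unfolding chart_quot_def
  by (subst chart_ring_single_iff)
    (auto simp: lookup_minus lookup_single when_def sum_subtractf)

lemma dehom_in_chart_ring: "dehom i t f \<in> chart_ring {i}"
proof (induction f rule: poly_mapping_monomial_induct)
  case (single m c)
  show ?case
  proof (cases "c = 0 \<or> mdeg m \<noteq> t")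
    case False
    then show ?thesis
      by (auto simp: dehom_single chart_ring_single_iff lookup_minus lookup_map_int lookup_single
          when_def sum_subtractf mdeg_def)
  qed (auto simp: dehom_single)
qed (simp add: dehom_add chart_ring_add)

lemma monomial_quot_in_chart_ring:
  "Poly_Mapping.single (Poly_Mapping.map int m - Poly_Mapping.single i (int (mdeg m))) c \<in> chart_ring {i}"
  using dehom_in_chart_ring[of i "mdeg m" "Poly_Mapping.single m c"] by (simp add: dehom_single)

section \<open>Ideals of chart rings and their extensions to overlaps\<close>

lemma ideal_of_zero: "ideal_of A J \<Longrightarrow> 0 \<in> J"
  and ideal_of_subset: "ideal_of A J \<Longrightarrow> J \<subseteq> A"
  and ideal_of_add: "ideal_of A J \<Longrightarrow> f \<in> J \<Longrightarrow> g \<in> J \<Longrightarrow> f + g \<in> J"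
  and ideal_of_mult: "ideal_of A J \<Longrightarrow> a \<in> A \<Longrightarrow> f \<in> J \<Longrightarrow> a * f \<in> J"
  by (auto simp: ideal_of_def)

lemma ideal_of_uminus: "ideal_of (chart_ring U) J \<Longrightarrow> f \<in> J \<Longrightarrow> - f \<in> J"
  using ideal_of_mult[of "chart_ring U" J "- 1" f] chart_ring_uminus[OF chart_ring_1, of U] by simp

lemma ideal_of_diff: "ideal_of (chart_ring U) J \<Longrightarrow> f \<in> J \<Longrightarrow> g \<in> J \<Longrightarrow> f - g \<in> J"
  using ideal_of_add[of "chart_ring U" J f "- g"] ideal_of_uminus[of U J g] by simp

lemma ideal_of_subspace:
  assumes "ideal_of (chart_ring U) J"
  shows "module.subspace cscale J"
proof -
  interpret vector_space cscale by (rule vector_space_cscale)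
  show ?thesis
    using assms by (auto simp: subspace_def cscale_def intro: ideal_of_zero ideal_of_add ideal_of_mult)
qed

lemma ideal_of_whole: "ideal_of (chart_ring U) (chart_ring U)"
  by (simp add: ideal_of_def chart_ring_add chart_ring_mult)

lemma ideal_of_hull:
  assumes "J \<subseteq> A" and A: "ideal_of A A"
  shows "ideal_of A (ideal_of A hull J)"
proof -
  have sub: "ideal_of A hull J \<subseteq> A"
    using assms by (rule hull_minimal)
  show ?thesis
    unfolding ideal_of_def[of A "ideal_of A hull J"]
  proof (intro conjI ballI)
    show "0 \<in> ideal_of A hull J"
      by (auto simp: hull_def intro: ideal_of_zero)
    show "f + g \<in> ideal_of A hull J" if "f \<in> ideal_of A hull J" "g \<in> ideal_of A hull J" for f g
      using that by (auto simp: hull_def intro: ideal_of_add)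
    show "a * f \<in> ideal_of A hull J" if "a \<in> A" "f \<in> ideal_of A hull J" for a f
      using that by (auto simp: hull_def intro: ideal_of_mult)
  qed (rule sub)
qed

text \<open>The overlap ideal is generated from chart \<open>i\<close> only; the gluing condition of
  \<open>closed_subscheme\<close> makes it contain \<open>J j\<close> as well.\<close>

lemma overlap_ideal_properties:
  assumes "closed_subscheme J"
  shows "ideal_of (chart_ring {i, j}) (overlap_ideal J i j)"
    and "J i \<subseteq> overlap_ideal J i j" and "J j \<subseteq> overlap_ideal J i j"
proof -
  have ideal: "ideal_of (chart_ring {i}) (J i)" for i
    using assms by (simp add: closed_subscheme_def)
  have "J i \<subseteq> chart_ring {i, j}"
    using ideal_of_subset[OF ideal] chart_ring_mono[of "{i}" "{i, j}"] by blast
  then show "ideal_of (chart_ring {i, j}) (overlap_ideal J i j)"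
    using ideal_of_hull ideal_of_whole unfolding overlap_ideal_def by blast
  have incl: "J i \<subseteq> overlap_ideal J i j" for i j
    unfolding overlap_ideal_def by (rule hull_subset)
  show "J i \<subseteq> overlap_ideal J i j" by (rule incl)
  show "J j \<subseteq> overlap_ideal J i j"
    using incl[of j i] assms by (simp add: closed_subscheme_def)
qed

section \<open>The homogeneous ideal of a closed subscheme\<close>

lemma homogeneous_ideal_ideal:
  assumes "closed_subscheme J"
  shows "0 \<in> homogeneous_ideal J"
    and "f \<in> homogeneous_ideal J \<Longrightarrow> g \<in> homogeneous_ideal J \<Longrightarrow> f + g \<in> homogeneous_ideal J"
    and "f \<in> homogeneous_ideal J \<Longrightarrow> a * f \<in> homogeneous_ideal J"
proof -
  have ideal: "ideal_of (chart_ring {i}) (J i)" for i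
    using assms by (simp add: closed_subscheme_def)
  show "0 \<in> homogeneous_ideal J"
    by (simp add: homogeneous_ideal_def dehom_def ideal_of_zero[OF ideal])
  show add: "f + g \<in> homogeneous_ideal J" if "f \<in> homogeneous_ideal J" "g \<in> homogeneous_ideal J" for f g
    using that by (simp add: homogeneous_ideal_def dehom_add ideal_of_add[OF ideal])
  show "a * f \<in> homogeneous_ideal J" if f: "f \<in> homogeneous_ideal J"
  proof (induction a rule: poly_mapping_monomial_induct)
    case (single m c)
    have "dehom i t (Poly_Mapping.single m c * f) \<in> J i" for i t
    proof (cases "t < mdeg m")
      case True
      then show ?thesis by (simp add: dehom_monomial_times_low ideal_of_zero[OF ideal])
    next
      case False
      then have "t = t - mdeg m + mdeg m" by simp
      then have "dehom i t (Poly_Mapping.single m c * f) =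
          Poly_Mapping.single (Poly_Mapping.map int m - Poly_Mapping.single i (int (mdeg m))) c * dehom i (t - mdeg m) f"
        using dehom_monomial_times by metis
      then show ?thesis
        using f ideal_of_mult[OF ideal monomial_quot_in_chart_ring] by (simp add: homogeneous_ideal_def)
    qed
    then show ?case by (simp add: homogeneous_ideal_def)
  qed (simp add: distrib_right add)
qed

text \<open>Multiplying by a power of \<open>y\<^sub>i\<close> does not change the dehomogenization
  on chart \<open>i\<close>, so each chart needs only a power of its own variable.\<close>

lemma homogeneous_ideal_saturated:
  assumes "\<And>i. \<exists>n. Poly_Mapping.single (Poly_Mapping.single i n) 1 * f \<in> homogeneous_ideal J"
  shows "f \<in> homogeneous_ideal J"
  unfolding homogeneous_ideal_def
proof (clarify)
  fix t i
  obtain n where "Poly_Mapping.single (Poly_Mapping.single i n) 1 * f \<in> homogeneous_ideal J"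
    using assms by blast
  then have "dehom i (t + n) (Poly_Mapping.single (Poly_Mapping.single i n) 1 * f) \<in> J i"
    by (simp add: homogeneous_ideal_def)
  moreover have "Poly_Mapping.map int (Poly_Mapping.single i n) - Poly_Mapping.single i (int n) = 0"
    by (rule poly_mapping_eqI) (simp add: lookup_minus lookup_map_int lookup_single when_def)
  ultimately show "dehom i t f \<in> J i"
    using dehom_monomial_times[of i t "Poly_Mapping.single i n" 1 f] by simp
qed

lemma subspace_homogeneous_ideal:
  assumes "closed_subscheme J"
  shows "module.subspace cscale (homogeneous_ideal J)"
proof -
  interpret vector_space cscale by (rule vector_space_cscale)
  show ?thesis
    using homogeneous_ideal_ideal[OF assms] by (simp add: subspace_def cscale_def)
qed

section \<open>The annihilator ideal\<close>

text \<open>In positive characteristic differentiation can kill coefficients, so the converse fails.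
  This direction holds over every field and suffices for counting degrees.\<close>

lemma keys_partial_power:
  "m \<in> Poly_Mapping.keys ((partial i ^^ n) F) \<Longrightarrow> m + Poly_Mapping.single i n \<in> Poly_Mapping.keys F"
proof (induction n arbitrary: m)
  case (Suc n)
  then have "m + Poly_Mapping.single i 1 \<in> Poly_Mapping.keys ((partial i ^^ n) F)"
    by (auto simp: in_keys_iff lookup_partial)
  from Suc.IH[OF this] show ?case
    by (simp add: add.assoc flip: single_add)
qed simp

lemma keys_fold_partial:
  fixes F :: "('v, 'k::field) mpoly"
  assumes "finite A"
    and "m \<in> Poly_Mapping.keys (Finite_Set.fold (\<lambda>i. partial i ^^ e i) F A)"
  shows "m + (\<Sum>i\<in>A. Poly_Mapping.single i (e i)) \<in> Poly_Mapping.keys F"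
proof -
  interpret comp_fun_commute "\<lambda>i. (partial i :: ('v, 'k) mpoly \<Rightarrow> _) ^^ e i"
    by (rule comp_fun_commute_partial_power)
  show ?thesis
    using assms
  proof (induction A arbitrary: m)
    case (insert i A)
    then have "m + Poly_Mapping.single i (e i) \<in> Poly_Mapping.keys (Finite_Set.fold (\<lambda>i. partial i ^^ e i) F A)"
      by (intro keys_partial_power) simp
    from insert.IH[OF this] insert.hyps show ?case
      by (simp add: add.assoc)
  qed simp
qed

text \<open>Both uses of the finite length of S/P rest on this: P contains a power of each variable,
  and the Hilbert function of S/P vanishes above \<open>k\<close>.\<close>

lemma annihilator_of_large_degree:
  assumes "form k F" "form e g" "k < e"
  shows "g \<in> annihilator F"
proof -
  have "monom_act m F = 0" if m: "m \<in> Poly_Mapping.keys g" for m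
  proof -
    have "Poly_Mapping.keys (monom_act m F) = {}"
    proof (rule ccontr)
      assume "Poly_Mapping.keys (monom_act m F) \<noteq> {}"
      then obtain m' where "m' \<in> Poly_Mapping.keys (monom_act m F)"
        by blast
      then have "m' + (\<Sum>i\<in>UNIV. Poly_Mapping.single i (Poly_Mapping.lookup m i)) \<in> Poly_Mapping.keys F"
        unfolding monom_act_def by (rule keys_fold_partial[OF finite])
      moreover have "(\<Sum>i\<in>UNIV. Poly_Mapping.single i (Poly_Mapping.lookup m i)) = m"
        by (rule poly_mapping_eqI) (simp add: lookup_sum lookup_single when_def)
      ultimately have "mdeg (m' + m) = k"
        using assms(1) by (auto simp: form_def)
      then show False
        using assms(2,3) m by (auto simp: form_def mdeg_add)
    qed
    then show ?thesis by simp
  qed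
  then show ?thesis
    by (simp add: annihilator_def diff_act_def cscale_def)
qed

section \<open>Ideals of S and saturation with respect to one element\<close>

definition ring_ideal :: "'a::comm_ring_1 set \<Rightarrow> bool"
  where "ring_ideal I \<longleftrightarrow> 0 \<in> I \<and> (\<forall>f\<in>I. \<forall>g\<in>I. f + g \<in> I) \<and> (\<forall>a. \<forall>f\<in>I. a * f \<in> I)"

lemma ring_ideal_mult: "ring_ideal I \<Longrightarrow> f \<in> I \<Longrightarrow> a * f \<in> I"
  by (simp add: ring_ideal_def)

lemma module_times: "module ((*) :: 'a::comm_ring_1 \<Rightarrow> 'a \<Rightarrow> 'a)"
  by unfold_locales (simp_all add: algebra_simps)

lemma ring_ideal_iff_subspace: "ring_ideal I \<longleftrightarrow> module.subspace (*) I"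
proof -
  interpret module "(*) :: 'a \<Rightarrow> 'a \<Rightarrow> 'a" by (rule module_times)
  show ?thesis by (simp add: ring_ideal_def subspace_def)
qed

lemma ring_ideal_span: "ring_ideal (module.span (*) G)"
  unfolding ring_ideal_iff_subspace by (rule module.subspace_span[OF module_times])

lemma ring_ideal_homogeneous_ideal: "closed_subscheme J \<Longrightarrow> ring_ideal (homogeneous_ideal J)"
  by (simp add: ring_ideal_def homogeneous_ideal_ideal)

lemma ring_ideal_subspace:
  assumes "ring_ideal I"
  shows "module.subspace cscale I"
proof -
  interpret vector_space cscale by (rule vector_space_cscale)
  show ?thesis
    using assms by (simp add: subspace_def cscale_def ring_ideal_def)
qed

text \<open>This is the saturation I : g^infinity. Unlike I itself, it contains \<open>u\<close>
  whenever it contains \<open>g * u\<close>, so \<open>g\<close> is never a zero divisor modulo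
  it.\<close>

definition power_colon :: "'a::comm_ring_1 set \<Rightarrow> 'a \<Rightarrow> 'a set"
  where "power_colon I g = {u. \<exists>n. g ^ n * u \<in> I}"

lemma subset_power_colon: "I \<subseteq> power_colon I g"
  by (auto simp: power_colon_def intro: exI[of _ 0])

lemma power_colon_times: "g * u \<in> power_colon I g \<Longrightarrow> u \<in> power_colon I g"
  unfolding power_colon_def by (auto simp: mult.assoc[symmetric] power_Suc2[symmetric] simp del: power_Suc)

lemma power_mult_ideal_mono:
  assumes "ring_ideal I" "g ^ n * u \<in> I" "n \<le> m"
  shows "g ^ m * u \<in> I"
proof -
  have "g ^ m * u = g ^ (m - n) * (g ^ n * u)"
    using assms(3) by (simp add: mult.assoc[symmetric] power_add[symmetric])
  then show ?thesis
    using assms by (simp add: ring_ideal_def)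
qed

lemma ring_ideal_power_colon:
  assumes I: "ring_ideal I"
  shows "ring_ideal (power_colon I g)"
  unfolding ring_ideal_def
proof (intro conjI ballI allI)
  show "0 \<in> power_colon I g"
    using I by (auto simp: power_colon_def ring_ideal_def)
  fix u assume "u \<in> power_colon I g"
  then obtain n where n: "g ^ n * u \<in> I"
    by (auto simp: power_colon_def)
  show "a * u \<in> power_colon I g" for a
  proof -
    have "g ^ n * (a * u) = a * (g ^ n * u)"
      by (simp add: mult.left_commute)
    then have "g ^ n * (a * u) \<in> I"
      using ring_ideal_mult[OF I n] by metis
    then show ?thesis
      by (auto simp: power_colon_def)
  qed
  fix v assume "v \<in> power_colon I g"
  then obtain m where m: "g ^ m * v \<in> I"
    by (auto simp: power_colon_def)
  have "g ^ max n m * u \<in> I" "g ^ max n m * v \<in> I"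
    using power_mult_ideal_mono[OF I n, of "max n m"] power_mult_ideal_mono[OF I m, of "max n m"] by auto
  then have "g ^ max n m * (u + v) \<in> I"
    using I by (simp add: distrib_left ring_ideal_def)
  then show "u + v \<in> power_colon I g"
    by (auto simp: power_colon_def)
qed

text \<open>The set is the radical of the colon ideal I : u. For sums, every term of the binomial
  expansion of \<open>(a + b) ^ (n + m)\<close> contains \<open>a ^ n\<close> or
  \<open>b ^ m\<close>.\<close>

lemma ring_ideal_radical_colon:
  assumes I: "ring_ideal I"
  shows "ring_ideal {a. u \<in> power_colon I a}"
  unfolding ring_ideal_def
proof (intro conjI ballI allI)
  \<comment> \<open>The exponent must be positive because \<open>0 ^ 0 = 1\<close>.\<close>
  have "0 ^ 1 * u \<in> I"
    using I by (simp add: ring_ideal_def)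
  then show "0 \<in> {a. u \<in> power_colon I a}"
    unfolding power_colon_def by blast
  fix a assume "a \<in> {a. u \<in> power_colon I a}"
  then obtain n where n: "a ^ n * u \<in> I"
    by (auto simp: power_colon_def)
  show "c * a \<in> {a. u \<in> power_colon I a}" for c
  proof -
    have "(c * a) ^ n * u = c ^ n * (a ^ n * u)"
      by (simp add: power_mult_distrib mult.assoc)
    then have "(c * a) ^ n * u \<in> I"
      using I n by (simp add: ring_ideal_def)
    then show ?thesis
      by (auto simp: power_colon_def)
  qed
  fix b assume "b \<in> {a. u \<in> power_colon I a}"
  then obtain m where m: "b ^ m * u \<in> I"
    by (auto simp: power_colon_def)
  have term_in: "of_nat (n + m choose k) * a ^ k * b ^ (n + m - k) * u \<in> I" for k
  proof (cases "n \<le> k")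
    case True
    have "of_nat (n + m choose k) * a ^ k * b ^ (n + m - k) * u =
        (of_nat (n + m choose k) * b ^ (n + m - k)) * (a ^ k * u)"
      by (simp add: mult.assoc mult.left_commute)
    then show ?thesis
      using ring_ideal_mult[OF I power_mult_ideal_mono[OF I n True]] by metis
  next
    case False
    then have "b ^ (n + m - k) * u \<in> I"
      using power_mult_ideal_mono[OF I m] by simp
    then show ?thesis
      using I by (simp add: ring_ideal_def mult.assoc)
  qed
  have "(\<Sum>k\<in>A. of_nat (n + m choose k) * a ^ k * b ^ (n + m - k) * u) \<in> I" if "finite A" for A
    using that term_in I by (induction A) (auto simp: ring_ideal_def)
  then have "(a + b) ^ (n + m) * u \<in> I"
    by (simp add: binomial_ring sum_distrib_right)
  then show "a + b \<in> {a. u \<in> power_colon I a}"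
    by (auto simp: power_colon_def)
qed

abbreviation var_power :: "'v \<Rightarrow> nat \<Rightarrow> ('v, 'k::field) mpoly"
  where "var_power i n \<equiv> Poly_Mapping.single (Poly_Mapping.single i n) 1"

lemma var_power_add: "var_power i (a + b) = var_power i a * var_power i b"
  by (simp add: mult_single single_add)

lemma var_power_power: "var_power i a ^ n = var_power i (a * n)"
  by (induction n) (simp_all add: var_power_add)

lemma form_var_power: "form n (var_power i n)"
  using form_single[of "Poly_Mapping.single i n" 1] by simp

text \<open>For each \<open>i\<close>, the radical of I : u contains the padded elements of
  \<open>T i\<close>. Therefore it contains a power of \<open>y\<^sub>i\<close>, so some power of
  each variable multiplies \<open>u\<close> into the saturated ideal I.\<close>

lemma saturated_colon:
  assumes J: "closed_subscheme J"
    and u: "\<And>i g. g \<in> T i \<Longrightarrow> e g \<le> d \<and> u \<in> power_colon (homogeneous_ideal J) (var_power i (d - e g) * g)"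
    and T: "\<And>i. var_power i (n i) \<in> module.span (*) (T i)"
  shows "u \<in> homogeneous_ideal J"
proof (rule homogeneous_ideal_saturated)
  fix i
  let ?I = "homogeneous_ideal J"
  interpret module "(*) :: ('a, 'b) mpoly \<Rightarrow> _" by (rule module_times)
  have ideal: "ring_ideal {a. u \<in> power_colon ?I a}"
    using J by (intro ring_ideal_radical_colon ring_ideal_homogeneous_ideal)
  \<comment> \<open>The padding exponents \<open>d - e g\<close> vary with \<open>g\<close>. The
    common factor \<open>var_power i d\<close> is a multiple of all these paddings and leaves an
    ideal on the right, so that the claim extends from \<open>T i\<close> to its span.\<close>
  have "span (T i) \<subseteq> {a. u \<in> power_colon ?I (var_power i d * a)}"
  proof (rule span_minimal)
    show "T i \<subseteq> {a. u \<in> power_colon ?I (var_power i d * a)}"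
    proof
      fix g assume "g \<in> T i"
      with u have g: "e g \<le> d" "u \<in> power_colon ?I (var_power i (d - e g) * g)"
        by auto
      have "var_power i d * g = var_power i (e g) * (var_power i (d - e g) * g)"
        using g(1) by (simp add: mult.assoc[symmetric] var_power_add[symmetric])
      then show "g \<in> {a. u \<in> power_colon ?I (var_power i d * a)}"
        using ring_ideal_mult[OF ideal, of "var_power i (d - e g) * g"] g(2) by (metis mem_Collect_eq)
    qed
    show "subspace {a. u \<in> power_colon ?I (var_power i d * a)}"
      unfolding subspace_def
    proof (intro conjI ballI allI)
      fix x assume x: "x \<in> {a. u \<in> power_colon ?I (var_power i d * a)}"
      show "c * x \<in> {a. u \<in> power_colon ?I (var_power i d * a)}" for c
        using ring_ideal_mult[OF ideal, of "var_power i d * x" c] x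
        by (simp only: mem_Collect_eq mult.left_commute[of c])
    qed (use ideal in \<open>simp_all add: ring_ideal_def distrib_left\<close>)
  qed
  with T have "u \<in> power_colon ?I (var_power i d * var_power i (n i))"
    by blast
  then have "u \<in> power_colon ?I (var_power i (d + n i))"
    by (simp only: var_power_add)
  then show "\<exists>n. var_power i n * u \<in> ?I"
    by (auto simp: power_colon_def var_power_power)
qed

section \<open>The inequality between the Hilbert functions\<close>

lemma linear_times: "Vector_Spaces.linear cscale cscale ((*) g)"
  unfolding Vector_Spaces.linear_def module_hom_def module_hom_axioms_def
  using vector_space_cscale
  by (auto simp: vector_space_def module_def distrib_left cscale_times_right)

lemma hilbert_function_step:
  fixes J :: "'v::finite \<Rightarrow> ('v, 'k::field) laurent set"
  assumes J: "closed_subscheme J" and P: "generated_in_degree d P"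
    and pow: "\<And>i. \<exists>n. var_power i n \<in> P"
    and fd: "quot_finite_dim cscale ({f. form (t + d) f} \<inter> P) ({f. form (t + d) f} \<inter> homogeneous_ideal J)"
    and sub: "homogeneous_ideal J \<subseteq> P"
  shows "quot_dim cscale {f. form t f} ({f. form t f} \<inter> homogeneous_ideal J) \<le>
    quot_dim cscale ({f. form (t + d) f} \<inter> P) ({f. form (t + d) f} \<inter> homogeneous_ideal J)"
proof -
  let ?I = "homogeneous_ideal J"
  interpret R: module "(*) :: ('v, 'k) mpoly \<Rightarrow> _" by (rule module_times)
  interpret vector_space "cscale :: 'k \<Rightarrow> ('v, 'k) mpoly \<Rightarrow> _" by (rule vector_space_cscale)
  obtain G where G: "\<forall>g\<in>G. \<exists>e\<le>d. form e g" and P_span: "P = R.span G"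
    using P by (auto simp: generated_in_degree_def)
  obtain e where e: "\<And>g. g \<in> G \<Longrightarrow> e g \<le> d \<and> form (e g) g"
    using G by metis
  have idealP: "ring_ideal P"
    unfolding P_span by (rule ring_ideal_span)
  \<comment> \<open>\<open>G\<close> may be infinite, but the filtration needs finitely many maps.
    The expression of one power of each variable involves only finitely many generators.\<close>
  have "\<exists>n T. finite T \<and> T \<subseteq> G \<and> var_power i n \<in> R.span T" for i :: 'v
  proof -
    obtain n where "var_power i n \<in> R.span G"
      using pow P_span by blast
    then obtain T r where "finite T" "T \<subseteq> G" "var_power i n = (\<Sum>a\<in>T. r a * a)"
      unfolding R.span_explicit by blast
    then show ?thesis
      by (metis (no_types, lifting) R.span_base R.span_scale R.span_sum)
  qed
  then obtain n T where T: "\<And>i::'v. finite (T i)" "\<And>i::'v. T i \<subseteq> G" "\<And>i. var_power i (n i) \<in> R.span (T i)"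
    by metis
  \<comment> \<open>Generators may have degree below \<open>d\<close>. Each one is padded to degree
    exactly \<open>d\<close> by the variable whose power it helps to express, the form in which
    \<open>saturated_colon\<close> recovers I.\<close>
  define A where "A = (\<Union>i. (\<lambda>g. var_power i (d - e g) * g) ` T i)"
  have "finite A"
    unfolding A_def using T by auto
  have A: "form d g \<and> g \<in> P" if g: "g \<in> A" for g
  proof -
    obtain i h where h: "h \<in> T i" "g = var_power i (d - e h) * h"
      using g by (auto simp: A_def)
    then have "h \<in> G"
      using T by blast
    then have "form (d - e h + e h) g" "e h \<le> d"
      unfolding h(2) using e[of h] form_times[OF form_var_power, of "e h" h "d - e h" i] by auto
    moreover have "g \<in> P"
      unfolding h(2) P_span using \<open>h \<in> G\<close> by (intro R.span_scale R.span_base)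
    ultimately show ?thesis by simp
  qed
  have I: "ring_ideal ?I"
    using J by (rule ring_ideal_homogeneous_ideal)
  have subV: "subspace {f. form m f}" for m
    by (rule subspace_forms)
  have subN: "subspace (power_colon ?I g)" for g
    by (intro ring_ideal_subspace ring_ideal_power_colon I)
  have colon_eq: "(\<Inter>g\<in>A. power_colon ?I g) = ?I"
  proof (intro equalityI subsetI)
    fix u assume u: "u \<in> (\<Inter>g\<in>A. power_colon ?I g)"
    show "u \<in> ?I"
    proof (rule saturated_colon[OF J _ T(3)])
      fix g i assume g: "g \<in> T i"
      then have "var_power i (d - e g) * g \<in> A"
        unfolding A_def by blast
      then show "e g \<le> d \<and> u \<in> power_colon ?I (var_power i (d - e g) * g)"
        using u g T(2) e by blast
    qed
  next
    fix u assume "u \<in> ?I"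
    then show "u \<in> (\<Inter>g\<in>A. power_colon ?I g)"
      using subset_power_colon[of ?I] by (simp add: subset_iff)
  qed
  have U_eq: "{f. form (t + d) f} \<inter> P \<inter> ?I = {f. form (t + d) f} \<inter> ?I"
    using sub by auto
  have "quot_dim cscale {f. form t f} ({f. form t f} \<inter> (\<Inter>g\<in>A. power_colon ?I g)) \<le>
    quot_dim cscale ({f. form (t + d) f} \<inter> P) ({f. form (t + d) f} \<inter> P \<inter> (\<Inter>g\<in>A. power_colon ?I g))"
  \<comment> \<open>Source and target are filtered by the same ideals I : g^infinity. Injectivity on
    a layer is \<open>power_colon_times\<close>, and invariance holds because they are
    ideals.\<close>
  proof (rule conjunct2[OF quot_dim_joint_inj[OF vector_space_cscale vector_space_cscale \<open>finite A\<close>,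
          where \<phi> = "(*)"]])
    show "Vector_Spaces.linear cscale cscale ((*) g)" for g :: "('v, 'k) mpoly"
      by (rule linear_times)
    show "subspace ({f. form (t + d) f} \<inter> P)"
      by (intro subspace_inter subV ring_ideal_subspace idealP)
    show "g * f \<in> {f. form (t + d) f} \<inter> P" if "g \<in> A" "f \<in> {f. form t f}" for g f
    proof -
      have "form (t + d) (f * g)"
        using that A by (auto intro: form_times)
      moreover have "f * g \<in> P"
        using that A ring_ideal_mult[OF idealP] by blast
      ultimately show ?thesis
        by (simp add: mult.commute)
    qed
    show "u \<in> power_colon ?I g" if "g * u \<in> power_colon ?I g" for g u
      using that by (rule power_colon_times)
    show "h * u \<in> power_colon ?I g" if "u \<in> power_colon ?I g" for g h u
      using that by (rule ring_ideal_mult[OF ring_ideal_power_colon[OF I]])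
    show "quot_finite_dim cscale ({f. form (t + d) f} \<inter> P)
        ({f. form (t + d) f} \<inter> P \<inter> (\<Inter>g\<in>A. power_colon ?I g))"
      unfolding colon_eq U_eq by (rule fd)
  qed (rule subN subV)+
  then show ?thesis
    unfolding colon_eq U_eq .
qed

section \<open>The Hilbert function is bounded by the degree\<close>

text \<open>The element \<open>1 - w\<close> divides \<open>1 - w ^ n\<close>. With
  \<open>w = z * q\<close> this leads from the relation in \<open>fitting\<close> to the Fitting
  idempotent.\<close>

lemma ideal_of_diff_sum_geometric:
  assumes L: "ideal_of (chart_ring W) L" and w: "w \<in> chart_ring W" and a: "a * (1 - w) \<in> L"
  shows "a * (1 - w ^ n) \<in> L"
proof -
  have "a * (1 - w ^ n) = (\<Sum>l<n. w ^ l) * (a * (1 - w))"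
    by (simp add: one_diff_power_eq mult.left_commute mult.assoc mult.commute)
  also have "\<dots> \<in> L"
    by (intro ideal_of_mult[OF L _ a] chart_ring_sum chart_ring_power w)
  finally show ?thesis .
qed

text \<open>Fitting's lemma for multiplication by \<open>z\<close>: modulo \<open>J\<close>, the element \<open>z * q\<close> acts as the identity on the
  part of the coordinate ring where \<open>z\<close> is invertible, and \<open>z ^ n\<close> kills the complementary part.\<close>

lemma fitting:
  assumes J: "ideal_of (chart_ring U) J" and fd: "quot_finite_dim cscale (chart_ring U) J"
    and z: "z \<in> chart_ring U"
  shows "\<exists>q n. q \<in> chart_ring U \<and> z ^ n * (1 - z * q) \<in> J"
\<comment> \<open>Independence concerns sets, so the powers of \<open>z\<close> can be counted only
  if they are distinct. If two of them coincide, a power of \<open>z\<close> serves as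
  \<open>q\<close>.\<close>
proof (cases "inj_on (\<lambda>k. z ^ k) {..quot_dim cscale (chart_ring U) J}")
  case False
  then obtain a b where "a < b" "z ^ a = z ^ b"
    unfolding inj_on_def by (metis linorder_neqE_nat)
  moreover have "z ^ a * (z * z ^ (b - a - 1)) = z ^ (a + Suc (b - a - 1))"
    by (simp add: power_add)
  ultimately have "z ^ a * (1 - z * z ^ (b - a - 1)) = 0"
    by (simp add: right_diff_distrib)
  then show ?thesis
    using ideal_of_zero[OF J] chart_ring_power[OF z] by metis
next
  case True
  interpret vector_space cscale by (rule vector_space_cscale)
  let ?D = "quot_dim cscale (chart_ring U) J"
  let ?C = "(\<lambda>k. z ^ k) ` {..?D}"
  have "\<not> independent_mod cscale J ?C"
  proof
    assume "independent_mod cscale J ?C"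
    then have "card ?C \<le> ?D"
      using chart_ring_power[OF z]
      by (intro card_le_quot_dim subspace_chart_ring ideal_of_subspace[OF J] fd) auto
    then show False
      using True by (simp add: card_image)
  qed
  then obtain c b where c: "(\<Sum>b\<in>?C. cscale (c b) b) \<in> J" and b: "b \<in> ?C" "c b \<noteq> 0"
    by (auto simp: independent_mod_def)
  define a where "a k = c (z ^ k)" for k
  have sum: "(\<Sum>k\<le>?D. cscale (a k) (z ^ k)) \<in> J"
    using c True by (simp add: sum.reindex a_def)
  obtain k1 where k1: "k1 \<le> ?D" "a k1 \<noteq> 0"
    using b by (auto simp: a_def)
  \<comment> \<open>Dividing the relation by its lowest nonzero coefficient isolates
    \<open>z ^ k0\<close>; all other terms are divisible by \<open>z ^ k0 * z\<close> and define
    \<open>q\<close>.\<close>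
  define k0 where "k0 = (LEAST k. a k \<noteq> 0)"
  have "a k0 \<noteq> 0"
    unfolding k0_def using k1(2) by (rule LeastI)
  moreover have "k0 \<le> k1"
    unfolding k0_def using k1(2) by (rule Least_le)
  ultimately have k0: "a k0 \<noteq> 0" "k0 \<le> ?D"
    using k1(1) by auto
  have below: "a k = 0" if "k < k0" for k
    using not_less_Least[OF that[unfolded k0_def]] by simp
  define q where "q = - (\<Sum>k\<in>{k0<..?D}. cscale (inverse (a k0) * a k) (z ^ (k - k0 - 1)))"
  have q: "q \<in> chart_ring U"
    unfolding q_def by (intro chart_ring_uminus chart_ring_sum chart_ring_cscale chart_ring_power z)
  have "(\<Sum>k\<le>?D. cscale (a k) (z ^ k)) = (\<Sum>k\<in>insert k0 {k0<..?D}. cscale (a k) (z ^ k))"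
    using k0 below by (intro sum.mono_neutral_right) (auto simp: not_le)
  also have "\<dots> = cscale (a k0) (z ^ k0) + (\<Sum>k\<in>{k0<..?D}. cscale (a k) (z ^ k))"
    by simp
  finally have "cscale (inverse (a k0)) (\<Sum>k\<le>?D. cscale (a k) (z ^ k)) =
      z ^ k0 + (\<Sum>k\<in>{k0<..?D}. cscale (inverse (a k0) * a k) (z ^ k))"
    using k0 by (simp add: scale_right_distrib scale_sum_right)
  also have "(\<Sum>k\<in>{k0<..?D}. cscale (inverse (a k0) * a k) (z ^ k)) =
      (\<Sum>k\<in>{k0<..?D}. z ^ k0 * (z * cscale (inverse (a k0) * a k) (z ^ (k - k0 - 1))))"
  proof (rule sum.cong)
    fix k assume "k \<in> {k0<..?D}"
    then have "k = k0 + Suc (k - k0 - 1)"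
      by auto
    then have "z ^ k = z ^ k0 * (z * z ^ (k - k0 - 1))"
      by (metis power_Suc power_add)
    then show "cscale (inverse (a k0) * a k) (z ^ k) =
        z ^ k0 * (z * cscale (inverse (a k0) * a k) (z ^ (k - k0 - 1)))"
      by (simp only: cscale_times_right)
  qed simp
  also have "\<dots> = - (z ^ k0 * (z * q))"
    by (simp add: q_def sum_distrib_left)
  finally have "cscale (inverse (a k0)) (\<Sum>k\<le>?D. cscale (a k) (z ^ k)) = z ^ k0 * (1 - z * q)"
    by (simp add: right_diff_distrib)
  moreover have "cscale (inverse (a k0)) (\<Sum>k\<le>?D. cscale (a k) (z ^ k)) \<in> J"
    using sum subspace_scale[OF ideal_of_subspace[OF J]] by blast
  ultimately show ?thesis
    using q by metis
qed

text \<open>The Fitting idempotents \<open>(z * q) ^ N\<close> of associated elements \<open>z\<close> and \<open>u * z\<close> agree modulo \<open>L\<close>, because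
  each of them is determined by the part on which \<open>z\<close> is invertible.\<close>

lemma fitting_associated:
  assumes L: "ideal_of (chart_ring W) L"
    and A: "z \<in> chart_ring W" "q \<in> chart_ring W" "q' \<in> chart_ring W" "u \<in> chart_ring W" "u' \<in> chart_ring W"
    and u: "u' * u = 1"
    and q: "z ^ N * (1 - z * q) \<in> L" and q': "(u * z) ^ N * (1 - (u * z) * q') \<in> L"
  shows "q ^ t * (z * q) ^ N - (u * q') ^ t * ((u * z) * q') ^ N \<in> L"
proof -
  let ?A = "chart_ring W"
  define e e' where "e = (z * q) ^ N" and "e' = ((u * z) * q') ^ N"
  define cong where "cong x y \<longleftrightarrow> x - y \<in> L" for x y
  have cong_trans: "cong x w" if "cong x y" "cong y w" for x y w
    using ideal_of_add[OF L that[unfolded cong_def]] by (simp add: cong_def)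
  have cong_sym: "cong y x" if "cong x y" for x y
    using ideal_of_uminus[OF L that[unfolded cong_def]] by (simp add: cong_def)
  have cong_mult: "cong (a * x) (a * y)" if "cong x y" "a \<in> ?A" for a x y
    using ideal_of_mult[OF L that(2) that(1)[unfolded cong_def]] by (simp add: cong_def right_diff_distrib)
  have mem: "z * q \<in> ?A" "(u * z) * q' \<in> ?A" "e \<in> ?A" "e' \<in> ?A"
    by (simp_all add: e_def e'_def A chart_ring_mult chart_ring_power)
  have e1: "z ^ N * (1 - e) \<in> L" and e1': "(u * z) ^ N * (1 - e') \<in> L"
    unfolding e_def e'_def by (intro ideal_of_diff_sum_geometric[OF L] mem q q')+
  have "z ^ N * (1 - e') = u' ^ N * ((u * z) ^ N * (1 - e'))"
    using u by (simp add: power_mult_distrib mult.assoc[symmetric] flip: power_mult_distrib)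
  then have ze': "z ^ N * (1 - e') \<in> L"
    using ideal_of_mult[OF L chart_ring_power[OF A(5)] e1'] by simp
  have "(u * z) ^ N * (1 - e) = u ^ N * (z ^ N * (1 - e))"
    by (simp add: power_mult_distrib mult.assoc)
  then have z'e: "(u * z) ^ N * (1 - e) \<in> L"
    using ideal_of_mult[OF L chart_ring_power[OF A(4)] e1] by simp
  \<comment> \<open>As \<open>e\<close> is a multiple of \<open>z ^ N\<close>, which is killed by
    \<open>1 - e'\<close>, it is absorbed by \<open>e'\<close>. By symmetry both are congruent to
    their product.\<close>
  have "e - e * e' = q ^ N * (z ^ N * (1 - e'))"
    by (simp add: e_def power_mult_distrib algebra_simps)
  then have "cong e (e * e')"
    using ideal_of_mult[OF L chart_ring_power[OF A(2)] ze'] by (simp add: cong_def)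
  moreover have "e' - e * e' = q' ^ N * ((u * z) ^ N * (1 - e))"
    by (simp add: e'_def power_mult_distrib algebra_simps)
  then have "cong e' (e * e')"
    using ideal_of_mult[OF L chart_ring_power[OF A(3)] z'e] by (simp add: cong_def)
  ultimately have ee': "cong e e'"
    using cong_trans cong_sym by blast
  \<comment> \<open>Uniqueness of inverses: on the part selected by \<open>e\<close>, both
    \<open>q\<close> and \<open>u * q'\<close> invert \<open>z\<close>.\<close>
  have qe: "cong (q * e) (u * q' * e)"
  proof -
    have "z ^ N * (1 - (u * z) * q') = u' ^ N * ((u * z) ^ N * (1 - (u * z) * q'))"
      using u by (simp add: power_mult_distrib mult.assoc[symmetric] flip: power_mult_distrib)
    then have "z ^ N * (1 - (u * z) * q') \<in> L"
      using ideal_of_mult[OF L chart_ring_power[OF A(5)] q'] by simp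
    from ideal_of_mult[OF L _ this, of "q * q ^ N"]
    have 1: "q * q ^ N * (z ^ N * (1 - (u * z) * q')) \<in> L"
      by (simp add: A chart_ring_mult chart_ring_power)
    have 2: "(u * q') * q ^ N * (z ^ N * (1 - z * q)) \<in> L"
      by (intro ideal_of_mult[OF L _ q] chart_ring_mult chart_ring_power A)
    have "q * e - u * q' * e =
        q * q ^ N * (z ^ N * (1 - (u * z) * q')) - (u * q') * q ^ N * (z ^ N * (1 - z * q))"
      by (simp add: e_def power_mult_distrib algebra_simps)
    then show ?thesis
      using ideal_of_diff[OF L 1 2] by (simp add: cong_def)
  qed
  have "cong (q ^ t * e) ((u * q') ^ t * e)"
  proof (induction t)
    case 0
    show ?case by (simp add: cong_def ideal_of_zero[OF L])
  next
    case (Suc t)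
    have "cong (q * (q ^ t * e)) (q * ((u * q') ^ t * e))"
      using Suc A by (intro cong_mult)
    moreover have "cong ((u * q') ^ t * (q * e)) ((u * q') ^ t * (u * q' * e))"
      using qe A by (intro cong_mult) (simp_all add: chart_ring_power chart_ring_mult)
    ultimately show ?case
      using cong_trans by (simp add: mult_ac)
  qed
  moreover have "cong ((u * q') ^ t * e) ((u * q') ^ t * e')"
    using ee' A by (intro cong_mult) (simp_all add: chart_ring_power chart_ring_mult)
  ultimately show ?thesis
    using cong_trans unfolding cong_def e_def e'_def by blast
qed

section \<open>The space of global sections\<close>

lemma subspace_families_vimage:
  assumes "module.subspace cscale K"
  shows "module.subspace (\<lambda>c s i. cscale c (s i)) {s :: 'v \<Rightarrow> ('a::comm_monoid_add \<Rightarrow>\<^sub>0 'k::field). s i \<in> K}"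
proof -
  interpret c: vector_space "cscale :: 'k \<Rightarrow> ('a \<Rightarrow>\<^sub>0 'k) \<Rightarrow> _" by (rule vector_space_cscale)
  interpret f: vector_space "\<lambda>c (s :: 'v \<Rightarrow> ('a \<Rightarrow>\<^sub>0 'k)) i. cscale c (s i)" by (rule vector_space_families)
  show ?thesis
    using assms by (simp add: f.subspace_def c.subspace_def)
qed

lemma linear_family_component:
  "Vector_Spaces.linear (\<lambda>c s i. cscale c (s i)) cscale
    (\<lambda>s :: 'v \<Rightarrow> ('a::comm_monoid_add \<Rightarrow>\<^sub>0 'k::field). s i)"
  unfolding Vector_Spaces.linear_def module_hom_def module_hom_axioms_def
  using vector_space_cscale vector_space_families
  by (auto simp: module_iff_vector_space)

lemma subspace_section_reps:
  fixes J :: "'v::finite \<Rightarrow> ('v, 'k::field) laurent set"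
  assumes J: "closed_subscheme J"
  shows "module.subspace (\<lambda>c s i. cscale c (s i)) (section_reps J)"
proof -
  interpret c: vector_space "cscale :: 'k \<Rightarrow> ('v, 'k) laurent \<Rightarrow> _" by (rule vector_space_cscale)
  interpret f: vector_space "\<lambda>c (s :: 'v \<Rightarrow> ('v, 'k) laurent) i. cscale c (s i)" by (rule vector_space_families)
  have L: "c.subspace (overlap_ideal J i j)" for i j
    by (rule ideal_of_subspace[OF overlap_ideal_properties(1)[OF J]])
  show ?thesis
    unfolding f.subspace_def section_reps_def
  proof (clarsimp, intro conjI allI impI)
    show "0 \<in> overlap_ideal J i j" for i j
      using c.subspace_0[OF L] .
    fix s assume s: "(\<forall>i. s i \<in> chart_ring {i}) \<and> (\<forall>i j. s i - s j \<in> overlap_ideal J i j)"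
    show "cscale c (s i) \<in> chart_ring {i}" for c i
      using s by (simp add: chart_ring_cscale)
    show "cscale c (s i) - cscale c (s j) \<in> overlap_ideal J i j" for c i j
      using s c.subspace_scale[OF L] by (simp flip: c.scale_right_diff_distrib)
    fix s' assume s': "(\<forall>i. s' i \<in> chart_ring {i}) \<and> (\<forall>i j. s' i - s' j \<in> overlap_ideal J i j)"
    show "s i + s' i \<in> chart_ring {i}" for i
      using s s' by (simp add: chart_ring_add)
    show "s i + s' i - (s j + s' j) \<in> overlap_ideal J i j" for i j
      using c.subspace_add[OF L, of "s i - s j" i j "s' i - s' j"] s s' by (simp add: algebra_simps)
  qed
qed

text \<open>Both chart ideals lie in the overlap ideal, so families in the \<open>J i\<close> glue.
  This exhibits them as a joint kernel on sections, as the filtration lemmas require.\<close>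

lemma zero_reps_eq:
  assumes J: "closed_subscheme J"
  shows "zero_reps J = {s \<in> section_reps J. \<forall>i\<in>UNIV. s i \<in> J i}"
proof -
  have "s i \<in> chart_ring {i} \<and> s i - s j \<in> overlap_ideal J i j" if "\<forall>i. s i \<in> J i" for s i j
  proof
    show "s i \<in> chart_ring {i}"
      using that J ideal_of_subset unfolding closed_subscheme_def by blast
    show "s i - s j \<in> overlap_ideal J i j"
      using that
      by (intro ideal_of_diff[OF overlap_ideal_properties(1)[OF J]]) (use overlap_ideal_properties(2,3)[OF J] in blast)+
  qed
  then show ?thesis
    by (auto simp: zero_reps_def section_reps_def)
qed

text \<open>Global sections embed into the finite product of the coordinate rings of the charts.
  Without finite dimension, \<open>scheme_degree\<close> would carry no information.\<close>

lemma sections_finite_dim: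
  assumes "finite_closed_subscheme J"
  shows "quot_finite_dim (\<lambda>c s i. cscale c (s i)) (section_reps J) (zero_reps J)"
proof -
  have J: "closed_subscheme J" and fd: "\<And>i. quot_finite_dim cscale (chart_ring {i}) (J i)"
    using assms by (auto simp: finite_closed_subscheme_def)
  show ?thesis
    unfolding zero_reps_eq[OF J]
  proof (rule conjunct1[OF conjunct2[OF quot_dim_filtration[OF vector_space_families vector_space_cscale finite,
            where \<phi> = "\<lambda>i s. s i" and U = "\<lambda>i. chart_ring {i}" and K = J]]])
    show "module.subspace cscale (J i)" for i
      using J ideal_of_subspace unfolding closed_subscheme_def by blast
    show "s i \<in> chart_ring {i}" if "s \<in> section_reps J" for s i
      using that by (simp add: section_reps_def)
  qed (rule linear_family_component subspace_section_reps[OF J] subspace_chart_ring fd)+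
qed

text \<open>A form \<open>f\<close> of degree \<open>t\<close> restricts to the function \<open>f / y\<^sub>i\<^sup>t\<close> on the open subscheme
  \<open>\<Gamma> \<inter> D\<^sub>+(y\<^sub>i)\<close>. As \<open>\<Gamma>\<close> is finite, this subscheme is also closed in \<open>\<Gamma>\<close>, and \<open>f / y\<^sub>i\<^sup>t\<close> extended by zero is
  a global section. Using these extensions for all \<open>i\<close> jointly replaces the usual division by a power of
  one linear form without zeros on \<open>\<Gamma>\<close>, which need not exist over a finite field.\<close>

lemma hilbert_function_le_degree:
  fixes J :: "'v::finite \<Rightarrow> ('v, 'k::field) laurent set"
  assumes fin: "finite_closed_subscheme J"
  shows "quot_finite_dim cscale {f. form t f} ({f. form t f} \<inter> homogeneous_ideal J) \<and>
    quot_dim cscale {f. form t f} ({f. form t f} \<inter> homogeneous_ideal J) \<le> scheme_degree J"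
proof -
  have J: "closed_subscheme J" and fd: "\<And>i. quot_finite_dim cscale (chart_ring {i}) (J i)"
    using fin by (auto simp: finite_closed_subscheme_def)
  have ideal: "ideal_of (chart_ring {i}) (J i)" for i
    using J by (simp add: closed_subscheme_def)
  have "\<forall>i j. \<exists>q n. q \<in> chart_ring {j} \<and> chart_quot j i ^ n * (1 - chart_quot j i * q) \<in> J j"
    by (intro allI fitting ideal fd chart_quot_in_chart_ring) simp
  then have "\<exists>q n. \<forall>i j. q i j \<in> chart_ring {j} \<and>
      chart_quot j i ^ n i j * (1 - chart_quot j i * q i j) \<in> J j"
    by (simp only: choice_iff)
  then obtain q n where q: "\<And>i j. q i j \<in> chart_ring {j}"
    and n: "\<And>i j. chart_quot j i ^ n i j * (1 - chart_quot j i * q i j) \<in> J j"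
    by blast
  \<comment> \<open>Comparing idempotents on an overlap requires the same exponent in both charts;
    the sum dominates every \<open>n i j\<close>.\<close>
  define N where "N = (\<Sum>i\<in>UNIV. \<Sum>j\<in>UNIV. n i j)"
  have N: "chart_quot j i ^ N * (1 - chart_quot j i * q i j) \<in> J j" for i j
  proof -
    have "n i j \<le> (\<Sum>j\<in>UNIV. n i j)"
      by (rule member_le_sum) auto
    also have "\<dots> \<le> N"
      unfolding N_def by (rule member_le_sum) auto
    finally have "chart_quot j i ^ N = chart_quot j i ^ (N - n i j) * (chart_quot j i ^ n i j :: ('v, 'k) laurent)"
      by (simp flip: power_add)
    moreover have "chart_quot j i ^ (N - n i j) * (chart_quot j i ^ n i j * (1 - chart_quot j i * q i j)) \<in> J j"
      by (intro ideal_of_mult[OF ideal _ n] chart_ring_power chart_quot_in_chart_ring) simp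
    ultimately show ?thesis
      by (simp add: mult.assoc)
  qed
  \<comment> \<open>Where \<open>y\<^sub>i\<close> is invertible, \<open>q i j\<close> is
    \<open>y\<^sub>j / y\<^sub>i\<close>. The factor \<open>q i j ^ t\<close> thus turns
    \<open>f / y\<^sub>j\<^sup>t\<close> into \<open>f / y\<^sub>i\<^sup>t\<close>, and the
    idempotent extends it by zero.\<close>
  define w where "w i j = q i j ^ t * (chart_quot j i * q i j) ^ N" for i j
  define \<phi> where "\<phi> i f = (\<lambda>j. w i j * dehom j t f)" for i f
  have w_in: "w i j \<in> chart_ring {j}" for i j
    unfolding w_def by (intro chart_ring_mult chart_ring_power q chart_quot_in_chart_ring) simp
  have glue: "w i j * dehom j t f - w i k * dehom k t f \<in> overlap_ideal J j k" for i j k f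
  proof -
    let ?L = "overlap_ideal J j k" and ?A = "chart_ring {j, k}"
    have L: "ideal_of ?A ?L" and sub: "J j \<subseteq> ?L" "J k \<subseteq> ?L"
      by (rule overlap_ideal_properties[OF J])+
    have inA: "x \<in> ?A" if "x \<in> chart_ring {j} \<or> x \<in> chart_ring {k}" for x
      using that chart_ring_mono[of "{j}" "{j, k}"] chart_ring_mono[of "{k}" "{j, k}"] by blast
    have quot: "chart_quot k i = (chart_quot k j * chart_quot j i :: ('v, 'k) laurent)"
      by (simp only: mult.commute[of "chart_quot k j"] chart_quot_times)
    have unit: "chart_quot j k * chart_quot k j = (1 :: ('v, 'k) laurent)"
      by (simp add: chart_quot_times)
    \<comment> \<open>On the overlap, \<open>y\<^sub>i / y\<^sub>k\<close> is
      \<open>y\<^sub>i / y\<^sub>j\<close> times the unit \<open>y\<^sub>j / y\<^sub>k\<close>. The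
      power \<open>t\<close> of this unit is also the factor between the two dehomogenizations of
      \<open>f\<close>.\<close>
    have "q i j ^ t * (chart_quot j i * q i j) ^ N -
        (chart_quot k j * q i k) ^ t * (chart_quot k j * chart_quot j i * q i k) ^ N \<in> ?L"
    proof (rule fitting_associated[OF L _ _ _ _ _ unit])
      show "chart_quot j i ^ N * (1 - chart_quot j i * q i j) \<in> ?L"
        using N sub by blast
      show "(chart_quot k j * chart_quot j i) ^ N * (1 - chart_quot k j * chart_quot j i * q i k) \<in> ?L"
        using N[of k i] sub unfolding quot by blast
    qed (auto intro: inA q chart_quot_in_chart_ring)
    then have "dehom j t f * (w i j - chart_quot k j ^ t * w i k) \<in> ?L"
      using ideal_of_mult[OF L inA] dehom_in_chart_ring[of j t f]
      by (simp add: w_def quot power_mult_distrib mult.assoc)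
    then show ?thesis
      unfolding dehom_change_chart[of k t f j] by (simp add: algebra_simps)
  qed
  have lin: "Vector_Spaces.linear cscale (\<lambda>c s j. cscale c (s j)) (\<phi> i)" for i
    unfolding Vector_Spaces.linear_def module_hom_def module_hom_axioms_def
    using vector_space_cscale vector_space_families
    by (auto simp: module_iff_vector_space \<phi>_def dehom_add dehom_cscale distrib_left cscale_times_right fun_eq_iff)
  interpret vector_space "cscale :: 'k \<Rightarrow> ('v, 'k) mpoly \<Rightarrow> _" by (rule vector_space_cscale)
  let ?s = "\<lambda>c (s :: 'v \<Rightarrow> ('v, 'k) laurent) i. cscale c (s i)"
  let ?N = "\<lambda>i. {f. dehom i t f \<in> J i}" and ?K = "\<lambda>i. {s. s i \<in> J i}"
  have V_eq: "{f. form t f} \<inter> (\<Inter>i\<in>UNIV. ?N i) = {f. form t f} \<inter> homogeneous_ideal J"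
  proof -
    have "f \<in> homogeneous_ideal J" if f: "form t f" "\<And>i. dehom i t f \<in> J i" for f
      unfolding homogeneous_ideal_def
    proof clarify
      show "dehom i t' f \<in> J i" for t' i
        using f dehom_form_other[OF f(1), of t' i] ideal_of_zero[OF ideal] by (cases "t' = t") auto
    qed
    then show ?thesis
      by (auto simp: homogeneous_ideal_def)
  qed
  have U_eq: "section_reps J \<inter> (\<Inter>i\<in>UNIV. ?K i) = zero_reps J"
    unfolding zero_reps_eq[OF J] by auto
  have "quot_finite_dim cscale {f. form t f} ({f. form t f} \<inter> (\<Inter>i\<in>UNIV. ?N i)) \<and>
    quot_dim cscale {f. form t f} ({f. form t f} \<inter> (\<Inter>i\<in>UNIV. ?N i)) \<le>
    quot_dim ?s (section_reps J) (section_reps J \<inter> (\<Inter>i\<in>UNIV. ?K i))"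
  proof (rule quot_dim_joint_inj[OF vector_space_cscale vector_space_families finite, where \<phi> = \<phi>])
    show "Vector_Spaces.linear cscale ?s (\<phi> i)" for i
      by (rule lin)
    show "subspace (?N i)" for i
      by (simp add: subspace_def dehom_add dehom_cscale ideal_of_add[OF ideal] dehom_def[of i t 0]
          ideal_of_zero[OF ideal] module.subspace_scale[OF _ ideal_of_subspace[OF ideal]]
          vector_space_cscale[unfolded module_iff_vector_space[symmetric]])
    show "module.subspace ?s (?K i)" for i
      by (rule subspace_families_vimage[OF ideal_of_subspace[OF ideal]])
    show "module.subspace ?s (section_reps J)"
      by (rule subspace_section_reps[OF J])
    show "\<phi> i f \<in> section_reps J" for i f
      by (simp add: section_reps_def \<phi>_def glue chart_ring_mult w_in dehom_in_chart_ring)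
    show "f \<in> ?N i" if "\<phi> i f \<in> ?K i" for i f
    proof -
      \<comment> \<open>On its own chart the coordinate quotient is 1, so the Fitting relation makes
        \<open>q i i\<close>, and with it \<open>w i i\<close>, congruent to 1: component
        \<open>i\<close> of \<open>\<phi> i f\<close> is \<open>f / y\<^sub>i\<^sup>t\<close> modulo
        \<open>J i\<close>.\<close>
      have "1 * (1 - q i i ^ (t + N)) \<in> J i"
        using N[of i i] by (intro ideal_of_diff_sum_geometric[OF ideal q]) simp
      then have "dehom i t f * (1 - w i i) \<in> J i"
        using ideal_of_mult[OF ideal dehom_in_chart_ring] by (simp add: w_def power_add)
      from ideal_of_add[OF ideal this, of "w i i * dehom i t f"] that show ?thesis
        by (simp add: \<phi>_def algebra_simps)
    qed
    show "\<phi> j f \<in> ?K i" if "f \<in> ?N i" for i j f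
      using that ideal_of_mult[OF ideal w_in] by (simp add: \<phi>_def)
    show "quot_finite_dim ?s (section_reps J) (section_reps J \<inter> (\<Inter>i\<in>UNIV. ?K i))"
      unfolding U_eq by (rule sections_finite_dim[OF fin])
  qed (rule subspace_forms)
  then show ?thesis
    unfolding V_eq U_eq scheme_degree_def .
qed

section \<open>The degree of the annihilator\<close>

lemma linear_hom_part: "Vector_Spaces.linear cscale cscale (hom_part t)"
  unfolding Vector_Spaces.linear_def module_hom_def module_hom_axioms_def
  using vector_space_cscale
  by (auto simp: module_iff_vector_space hom_part_add hom_part_cscale)

text \<open>A polynomial whose components below degree \<open>M\<close> lie in \<open>P\<close> lies
  in \<open>P\<close> itself, so finitely many graded pieces control the whole quotient.\<close>

lemma ideal_degree_le_sum:
  assumes P: "ring_ideal P" and high: "\<And>e f. form e f \<Longrightarrow> M \<le> e \<Longrightarrow> f \<in> P"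
    and fd: "\<And>t. quot_finite_dim cscale {f. form t f} ({f. form t f} \<inter> P)"
  shows "ideal_degree P \<le> (\<Sum>t<M. quot_dim cscale {f. form t f} ({f. form t f} \<inter> P))"
proof -
  interpret vector_space cscale by (rule vector_space_cscale)
  let ?W = "{f \<in> UNIV. \<forall>t\<in>{..<M}. hom_part t f \<in> {f. form t f} \<inter> P}"
  have filtration: "subspace ?W \<and> quot_finite_dim cscale UNIV ?W \<and>
      quot_dim cscale UNIV ?W \<le> (\<Sum>t\<in>{..<M}. quot_dim cscale {f. form t f} ({f. form t f} \<inter> P))"
    by (rule quot_dim_filtration[OF vector_space_cscale vector_space_cscale])
      (auto intro: linear_hom_part subspace_forms subspace_inter ring_ideal_subspace[OF P] form_hom_part fd)
  have "?W \<subseteq> P"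
  proof
    fix f assume f: "f \<in> ?W"
    have in_P: "hom_part t f \<in> P" for t
      using f high[OF form_hom_part] by (cases "t < M") auto
    obtain n where "(\<Sum>t<n. hom_part t f) = f"
      using finite_sum_hom_part by blast
    then show "f \<in> P"
      using subspace_sum[OF ring_ideal_subspace[OF P], of "{..<n}" "\<lambda>t. hom_part t f"] in_P by simp
  qed
  then have "ideal_degree P \<le> quot_dim cscale UNIV ?W"
    unfolding ideal_degree_def using filtration ring_ideal_subspace[OF P]
    by (intro quot_dim_mono(2)) auto
  then show ?thesis
    using filtration by simp
qed

text \<open>The induction advances by blocks of \<open>d\<close> consecutive degrees, so all residue
  classes telescope together.\<close>

lemma sum_le_by_period:
  fixes H h :: "nat \<Rightarrow> nat"
  assumes "\<And>t. H t \<le> h t" and "\<And>t. H (t + d) + h t \<le> h (t + d)"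
  shows "(\<Sum>t<d * Suc m. H t) \<le> (\<Sum>r<d. h (r + d * m))"
proof (induction m)
  case 0
  show ?case by (simp add: sum_mono assms(1))
next
  case (Suc m)
  have split: "(\<Sum>t<a + b. H t) = (\<Sum>t<a. H t) + (\<Sum>r<b. H (r + a))" for a b
    by (induction b) (simp_all add: add.commute)
  have "(\<Sum>t<d * Suc (Suc m). H t) = (\<Sum>t<d * Suc m. H t) + (\<Sum>r<d. H (r + d * Suc m))"
    by (simp only: mult_Suc_right[of d "Suc m"] add.commute[of d] split)
  also have "\<dots> \<le> (\<Sum>r<d. h (r + d * m) + H (r + d * m + d))"
    using Suc by (simp add: sum.distrib algebra_simps)
  also have "\<dots> \<le> (\<Sum>r<d. h (r + d * Suc m))"
  proof (rule sum_mono)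
    show "h (r + d * m) + H (r + d * m + d) \<le> h (r + d * Suc m)" for r
      using assms(2)[of "r + d * m"] by (simp add: ac_simps)
  qed
  finally show ?case .
qed

theorem proposition1:
  fixes F :: "('v::finite, 'k::field) mpoly"
    and \<Gamma> :: "'v \<Rightarrow> ('v, 'k) laurent set"
    and d k :: nat
  assumes "F \<noteq> 0" and "form k F"
    and "d \<ge> 1" and "generated_in_degree d (annihilator F)"
    and "finite_closed_subscheme \<Gamma>" and "apolar \<Gamma> F"
  shows "real (scheme_degree \<Gamma>) \<ge> 1 / real d * real (ideal_degree (annihilator F))"
proof -
  interpret vector_space "cscale :: 'k \<Rightarrow> ('v, 'k) mpoly \<Rightarrow> _" by (rule vector_space_cscale)
  let ?P = "annihilator F" and ?I = "homogeneous_ideal \<Gamma>"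
  let ?S = "\<lambda>t. {f :: ('v, 'k) mpoly. form t f}"
  have \<Gamma>: "closed_subscheme \<Gamma>"
    using assms(5) by (simp add: finite_closed_subscheme_def)
  have sub: "?I \<subseteq> ?P"
    using assms(6) by (simp add: apolar_def)
  \<comment> \<open>The ideal property is read off from the generators: the annihilator equals a
    span in S over itself.\<close>
  have P: "ring_ideal ?P"
    using assms(4) ring_ideal_span unfolding generated_in_degree_def by metis
  define h where "h t = quot_dim cscale (?S t) (?S t \<inter> ?I)" for t
  define H where "H t = quot_dim cscale (?S t) (?S t \<inter> ?P)" for t
  have subsp: "subspace (?S t)" "subspace (?S t \<inter> ?P)" "subspace (?S t \<inter> ?I)" for t
    by (intro subspace_inter subspace_forms ring_ideal_subspace P subspace_homogeneous_ideal[OF \<Gamma>])+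
  have fdI: "quot_finite_dim cscale (?S t) (?S t \<inter> ?I)" and h_le: "h t \<le> scheme_degree \<Gamma>" for t
    using hilbert_function_le_degree[OF assms(5), of t] by (auto simp: h_def)
  have fdP: "quot_finite_dim cscale (?S t) (?S t \<inter> ?P)" and H_le: "H t \<le> h t" for t
    unfolding H_def h_def
    using sub by (auto intro!: quot_dim_mono[OF subsp(1,3) subsp(1,2) fdI order_refl])
  have fdPI: "quot_finite_dim cscale (?S t \<inter> ?P) (?S t \<inter> ?I)" for t
    by (rule quot_dim_mono(1)[OF subsp(1,3) subsp(2,3) fdI Int_lower1 order_refl])
  have "H (t + d) + h t \<le> h (t + d)" for t
  proof -
    have "\<exists>n. var_power i n \<in> ?P" for i
      using annihilator_of_large_degree[OF assms(2) form_var_power lessI] by blast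
    then have "h t \<le> quot_dim cscale (?S (t + d) \<inter> ?P) (?S (t + d) \<inter> ?I)"
      unfolding h_def by (intro hilbert_function_step \<Gamma> assms(4) fdPI sub)
    moreover have "h (t + d) = H (t + d) + quot_dim cscale (?S (t + d) \<inter> ?P) (?S (t + d) \<inter> ?I)"
      unfolding h_def H_def using sub by (intro quot_dim_add(2) subsp fdP fdPI) auto
    ultimately show ?thesis by simp
  qed
  \<comment> \<open>Taking \<open>k + 1\<close> blocks reaches degree \<open>d * Suc k\<close>,
    which exceeds \<open>k\<close> because \<open>d \<ge> 1\<close>; from there on P contains all
    forms.\<close>
  with H_le have "(\<Sum>t<d * Suc k. H t) \<le> (\<Sum>r<d. h (r + d * k))"
    by (intro sum_le_by_period)
  also have "\<dots> \<le> d * scheme_degree \<Gamma>"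
    using sum_bounded_above[of "{..<d}" "\<lambda>r. h (r + d * k)" "scheme_degree \<Gamma>"] h_le by simp
  finally have "(\<Sum>t<d * Suc k. H t) \<le> d * scheme_degree \<Gamma>" .
  moreover have "ideal_degree ?P \<le> (\<Sum>t<d * Suc k. H t)"
    unfolding H_def
  proof (rule ideal_degree_le_sum[OF P _ fdP])
    fix e and f :: "('v, 'k) mpoly"
    assume "form e f" "d * Suc k \<le> e"
    moreover have "1 * Suc k \<le> d * Suc k"
      using assms(3) by (intro mult_le_mono1)
    ultimately show "f \<in> ?P"
      by (intro annihilator_of_large_degree[OF assms(2)]) auto
  qed
  ultimately have "ideal_degree ?P \<le> d * scheme_degree \<Gamma>"
    by linarith
  then have "real (ideal_degree ?P) \<le> real d * real (scheme_degree \<Gamma>)"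
    by (metis of_nat_le_iff of_nat_mult)
  then show ?thesis
    using assms(3) by (simp add: field_simps)
qed

end
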